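(* Let $n\ge1$. There is a constant $c>0$ such that $$[a]_{\mathcal{A}_\infty}\le c\,[a]_{Q_0}\quad\text{for all }a\in Q_0(\mathbb{R}^n).$$
   Context: $Q_0(\mathbb{R}^n)$ is the set of measurable functions $f$ on $\mathbb{R}^n$ with $$[f]_{Q_0}^2=\sup_{x\in\mathbb{R}^n,\,r>0}\frac{1}{r^n}\int_{B_r(x)}\int_{B_r(x)}\frac{|f(y)-f(z)|^2}{|y-z|^n}\,dy\,dz<\infty.$$ (One has $Q_0(\mathbb{R}^n)\subset\mathrm{BMO}(\mathbb{R}^n)$, so the Poisson integral below converges.) Put $\gamma_n=\Gamma(\frac{n+1}{2})/\pi^{(n+1)/2}$ and let $p_t(x)=t^{-n}p(x/t)$, $p(x)=\gamma_n(1+|x|^2)^{-(n+1)/2}$ be the Poisson kernel. For measurable $v$ on $\mathbb{R}^n$, $$|d_{1/2}v|_{od}^2(x)=\frac{\gamma_n}{2}\int_{\mathbb{R}^n}\frac{|v(x+h)-v(x)|^2}{|h|^{n+1}}\,dh.$$ The seminorm $[a]_{\mathcal{A}_\infty}$ is defined by $$[a]_{\mathcal{A}_\infty}^2=\sup_{r>0}\sup_{x\in\mathbb{R}^n}\int_0^r\frac{1}{|B_r(x)|}\int_{B_r(x)}|d_{1/2}(p_t*a)|_{od}^2(y)\,dy\,dt.$$ *)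

theory Defs
  imports "HOL-Analysis.Analysis"
begin

(* The square root on [0,\<infinity>]. The value \<infinity> is separated out because
   enn2real sends it to 0. *)
definition ennreal_sqrt :: "ennreal \<Rightarrow> ennreal" where
  "ennreal_sqrt x = (if x = \<infinity> then \<infinity> else ennreal (sqrt (enn2real x)))"

definition Q0_energy :: "(real ^ 'n \<Rightarrow> real) \<Rightarrow> ennreal" where
  "Q0_energy f =
     (SUP x. SUP r\<in>{0<..}.
        ennreal (1 / r ^ CARD('n)) *
        (\<integral>\<^sup>+z\<in>ball x r. (\<integral>\<^sup>+y\<in>ball x r.
            ennreal (\<bar>f y - f z\<bar>\<^sup>2 / norm (y - z) ^ CARD('n)) \<partial>lebesgue) \<partial>lebesgue))"

definition Q0_seminorm :: "(real ^ 'n \<Rightarrow> real) \<Rightarrow> ennreal" where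
  "Q0_seminorm f = ennreal_sqrt (Q0_energy f)"

definition Q0_space :: "(real ^ 'n \<Rightarrow> real) set" where
  "Q0_space = {f. f \<in> borel_measurable lebesgue \<and> Q0_energy f < \<infinity>}"

definition gamma_const :: "nat \<Rightarrow> real" where
  "gamma_const n = Gamma ((real n + 1) / 2) / pi powr ((real n + 1) / 2)"

definition poisson_profile :: "real ^ 'n \<Rightarrow> real" where
  "poisson_profile x =
     gamma_const CARD('n) * (1 + (norm x)\<^sup>2) powr (- (real CARD('n) + 1) / 2)"

definition poisson_kernel :: "real \<Rightarrow> real ^ 'n \<Rightarrow> real" where
  "poisson_kernel t x = (1 / t ^ CARD('n)) * poisson_profile (x /\<^sub>R t)"

(* The convolution of the Poisson kernel at height t with a. The integral is a Bochner
   integral, with value 0 where the integrand is not integrable; for a in Q0_space and t > 0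
   it always converges, because such a have bounded mean oscillation. *)
definition poisson_ext :: "(real ^ 'n \<Rightarrow> real) \<Rightarrow> real \<Rightarrow> real ^ 'n \<Rightarrow> real" where
  "poisson_ext a t x = (LINT y|lebesgue. poisson_kernel t (x - y) * a y)"

(* The square of the pointwise length of the half-order difference of v. *)
definition d_half_sq :: "(real ^ 'n \<Rightarrow> real) \<Rightarrow> real ^ 'n \<Rightarrow> ennreal" where
  "d_half_sq v x =
     ennreal (gamma_const CARD('n) / 2) *
     (\<integral>\<^sup>+h. ennreal (\<bar>v (x + h) - v x\<bar>\<^sup>2 / norm h ^ (CARD('n) + 1)) \<partial>lebesgue)"

definition A_inf_energy :: "(real ^ 'n \<Rightarrow> real) \<Rightarrow> ennreal" where
  "A_inf_energy a =
     (SUP r\<in>{0<..}. SUP x.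
        (\<integral>\<^sup>+t\<in>{0<..<r}.
           (\<integral>\<^sup>+y\<in>ball x r. d_half_sq (poisson_ext a t) y \<partial>lebesgue)
             / emeasure lebesgue (ball x r) \<partial>lebesgue))"

definition A_inf_seminorm :: "(real ^ 'n \<Rightarrow> real) \<Rightarrow> ennreal" where
  "A_inf_seminorm a = ennreal_sqrt (A_inf_energy a)"

end

theory Submission
  imports Defs
begin

text \<open>
  Let \<open>k\<^sub>t(x) = t / (t + |x|)^(n+1)\<close>, which is comparable to the Poisson kernel, and let
  \<open>V\<^sub>t(y)\<close> be the double integral of \<open>k\<^sub>t(y - z) k\<^sub>t(y - w) |a(z) - a(w)|\<^sup>2\<close>. Everything is reduced to \<open>V\<close>.
  Subtracting a mean of \<open>a\<close> and applying Cauchy-Schwarz to \<open>u = p\<^sub>t * a\<close> (with a gradient bound when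
  \<open>|h| \<le> t\<close>) gives \<open>\<integral> |u(y+h) - u(y)|\<^sup>2 / |h|^(n+1) dh \<le> C V\<^sub>t(y) / t\<close>, because \<open>1 / |h|^(n+1)\<close> is at most
  a multiple of \<open>k\<^sub>t(h) / t\<close> for \<open>|h| > t\<close> and \<open>k\<^sub>t * k\<^sub>t\<close> is at most a multiple of \<open>k\<^sub>t\<close>.
  To integrate \<open>V\<^sub>t(y) / t\<close> over \<open>y \<in> B\<^sub>r(x)\<close> and \<open>0 < t < r\<close>, distinguish two cases. If \<open>z\<close> and \<open>w\<close>
  lie in \<open>B\<^sub>2\<^sub>r(x)\<close>, the integrals in \<open>y\<close> and \<open>t\<close> leave a multiple of \<open>|z - w|^(-n)\<close>, and the energy
  of \<open>a\<close> on \<open>B\<^sub>2\<^sub>r(x)\<close> appears. Otherwise they leave at most a multiple of \<open>r^n k\<^sub>r(x - z) k\<^sub>r(x - w)\<close>,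
  hence of \<open>r^n V\<^sub>r(x)\<close>, and \<open>V\<^sub>r(x)\<close> is bounded by a telescoping over dyadic balls.
\<close>

subsection \<open>Integrals of the comparison kernel\<close>

text \<open>The obstacle is the factor 1/t, which is not integrable near t = 0. Two mechanisms
  compensate it. If z and w are both near x, the integral in y leaves a multiple of k_t(z - w) / t =
  (t + |z - w|)^(-n-1), which is integrable down to t = 0 off the diagonal; its time integral is the
  singular weight of the Q_0 energy. If one of the points is far from x, its kernel at scale t is at
  most a multiple of t/r times the kernel at scale r, and this t cancels the 1/t. The Poisson kernel
  enters only through a two-sided comparison with k_t and a Lipschitz bound at scale t. Its total
  mass is never evaluated: a lower bound for the mass and its invariance under translation allow a
  mean of a to be subtracted. Convergence of the Poisson integral is read off from the finiteness of
  V. All oscillations are values of one bilinear form in two weights, so that a single averaging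
  inequality serves both for balls and for kernels.\<close>

lemma dyadic_bracket:
  fixes s :: real
  assumes "s \<ge> 1"
  obtains k :: nat where "2 ^ k \<le> s" "s < 2 ^ Suc k"
proof -
  obtain m where m: "s < 2 ^ m"
    using real_arch_pow[of 2 s] by auto
  define j where "j = (LEAST j. s < 2 ^ j)"
  have j: "s < 2 ^ j"
    unfolding j_def by (rule LeastI[of _ m]) (rule m)
  have "j \<noteq> 0"
    using j assms by (intro notI) simp
  then obtain k where k: "j = Suc k"
    by (cases j) auto
  have "\<not> s < 2 ^ k"
    using not_less_Least[of k "\<lambda>j. s < 2 ^ j"] k unfolding j_def by auto
  with j k show ?thesis
    by (intro that[of k]) auto
qed

lemma nn_integral_lborel_reflect:
  fixes f :: "'a::euclidean_space \<Rightarrow> ennreal"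
  assumes [measurable]: "f \<in> borel_measurable borel"
  shows "(\<integral>\<^sup>+x. f (c - x) \<partial>lborel) = (\<integral>\<^sup>+x. f x \<partial>lborel)"
proof -
  have "(\<integral>\<^sup>+x. f x \<partial>lborel) = (\<integral>\<^sup>+x. f x \<partial>distr lborel borel (\<lambda>x. c + (-1) *\<^sub>R x))"
    by (subst lborel_affine[of "-1" c]) (auto simp: density_1)
  then show ?thesis
    by (simp add: nn_integral_distr)
qed

lemma nn_integral_lborel_translate:
  fixes f :: "'a::euclidean_space \<Rightarrow> ennreal"
  assumes [measurable]: "f \<in> borel_measurable borel"
  shows "(\<integral>\<^sup>+x. f (c + x) \<partial>lborel) = (\<integral>\<^sup>+x. f x \<partial>lborel)"
proof -
  have "(\<integral>\<^sup>+x. f x \<partial>lborel) = (\<integral>\<^sup>+x. f x \<partial>distr lborel borel ((+) c))"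
    by (simp add: lborel_distr_plus)
  then show ?thesis
    by (simp add: nn_integral_distr)
qed

lemma ennreal_term_le_suminf: "f k \<le> (\<Sum>k. f k :: ennreal)"
  using sum_le_suminf[OF summableI, of "{k}" f] by simp

text \<open>The denominator is a power of the linear expression t + |x|, not of t^2 + |x|^2, so that
  comparing two values reduces to the triangle inequality.\<close>

definition kern :: "real \<Rightarrow> 'a::euclidean_space \<Rightarrow> real" where
  "kern t x = t / (t + norm x) ^ (DIM('a) + 1)"

lemma kern_measurable [measurable]:
  assumes [measurable]: "f \<in> borel_measurable M" "g \<in> borel_measurable M"
  shows "(\<lambda>x. kern (f x) (g x)) \<in> borel_measurable M"
  unfolding kern_def by (intro borel_measurable_divide borel_measurable_power borel_measurable_add) measurable

lemma kern_nonneg [simp]: "t \<ge> 0 \<Longrightarrow> kern t x \<ge> 0"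
  by (simp add: kern_def)

lemma kern_pos: "t > 0 \<Longrightarrow> kern t x > 0"
  by (simp add: kern_def add_pos_nonneg)

lemma kern_uminus [simp]: "kern t (- x) = kern t x"
  by (simp add: kern_def)

lemma kern_minus_commute: "kern t (x - y) = kern t (y - x)"
  by (simp add: kern_def norm_minus_commute)

lemma kern_compare:
  fixes x y :: "'a::euclidean_space"
  assumes "t > 0" "c > 0" "t + norm x \<le> c * (t + norm y)"
  shows "kern t y \<le> c ^ (DIM('a) + 1) * kern t x"
proof -
  have pos: "t + norm x > 0" "t + norm y > 0"
    using assms by (simp_all add: add_pos_nonneg)
  have "(t + norm x) ^ (DIM('a) + 1) \<le> (c * (t + norm y)) ^ (DIM('a) + 1)"
    using assms pos by (intro power_mono) auto
  then have "(t + norm x) ^ (DIM('a) + 1) \<le> c ^ (DIM('a) + 1) * (t + norm y) ^ (DIM('a) + 1)"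
    by (simp only: power_mult_distrib)
  then have "t * (t + norm x) ^ (DIM('a) + 1) \<le> t * (c ^ (DIM('a) + 1) * (t + norm y) ^ (DIM('a) + 1))"
    using assms by (intro mult_left_mono) auto
  moreover have "0 < (t + norm x) ^ (DIM('a) + 1)" "0 < (t + norm y) ^ (DIM('a) + 1)"
    using pos by simp_all
  moreover have "t / q \<le> C * (t / p)" if "t * p \<le> t * (C * q)" "0 < p" "0 < q" for p q C :: real
    using that by (simp add: field_simps)
  ultimately show ?thesis
    unfolding kern_def by blast
qed

text \<open>This is t / (2^(k-1) t)^(n+1), the bound for the kernel at distance at least 2^(k-1) t.
  The type argument only carries the dimension.\<close>

definition dyadic_weight :: "'a::euclidean_space itself \<Rightarrow> real \<Rightarrow> nat \<Rightarrow> real" where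
  "dyadic_weight _ t k = (2 ^ (DIM('a) + 1)) / (2 ^ (DIM('a) + 1)) ^ k / t ^ DIM('a)"

lemma dyadic_weight_nonneg: "t > 0 \<Longrightarrow> dyadic_weight TYPE('a::euclidean_space) t k \<ge> 0"
  by (simp add: dyadic_weight_def)

text \<open>A single term dominates: the one of index k + 1 if 2^k t <= |x - z| < 2^(k+1) t, and the
  one of index 0 if |x - z| < t.\<close>

lemma kern_le_dyadic_sum:
  fixes x :: "'a::euclidean_space"
  assumes t: "t > 0"
  shows "ennreal (kern t (x - z)) \<le>
    (\<Sum>k. ennreal (dyadic_weight TYPE('a) t k) * indicator (ball x (2 ^ k * t)) z)"
proof -
  let ?N = "DIM('a)"
  have "\<exists>k. z \<in> ball x (2 ^ k * t) \<and> kern t (x - z) \<le> dyadic_weight TYPE('a) t k"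
  proof (cases "norm (x - z) < t")
    case True
    have "kern t (x - z) \<le> t / t ^ (?N + 1)"
      unfolding kern_def using t by (intro divide_left_mono power_mono mult_pos_pos zero_less_power) (auto simp: add_pos_nonneg)
    also have "\<dots> = 1 * (1 / t ^ ?N)"
      using t by simp
    also have "\<dots> \<le> 2 ^ (?N + 1) * (1 / t ^ ?N)"
      using t by (intro mult_right_mono one_le_power) auto
    finally show ?thesis
      using True by (intro exI[of _ 0]) (auto simp: dist_norm dyadic_weight_def)
  next
    case False
    then have "norm (x - z) / t \<ge> 1"
      using t by simp
    then obtain k where k: "2 ^ k \<le> norm (x - z) / t" "norm (x - z) / t < 2 ^ Suc k"
      by (rule dyadic_bracket)
    then have k': "2 ^ k * t \<le> norm (x - z)" "norm (x - z) < 2 ^ Suc k * t"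
      using t by (simp_all only: pos_le_divide_eq pos_divide_less_eq)
    have "kern t (x - z) \<le> t / (2 ^ k * t) ^ (?N + 1)"
      unfolding kern_def using t k' by (intro divide_left_mono power_mono mult_pos_pos zero_less_power) (auto simp: add_pos_nonneg)
    also have "\<dots> = 1 / ((2 ^ k) ^ (?N + 1)) / t ^ ?N"
      using t by (simp add: power_mult_distrib)
    also have "\<dots> = dyadic_weight TYPE('a) t (Suc k)"
      unfolding dyadic_weight_def by (simp add: power_mult[symmetric] mult.commute power_add field_simps)
    finally show ?thesis
      using k' by (intro exI[of _ "Suc k"]) (auto simp: dist_norm)
  qed
  then obtain k where k: "z \<in> ball x (2 ^ k * t)" "kern t (x - z) \<le> dyadic_weight TYPE('a) t k"
    by blast
  have "ennreal (kern t (x - z)) \<le> ennreal (dyadic_weight TYPE('a) t k) * indicator (ball x (2 ^ k * t)) z"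
    using k by (simp add: ennreal_leI)
  also have "\<dots> \<le> (\<Sum>k. ennreal (dyadic_weight TYPE('a) t k) * indicator (ball x (2 ^ k * t)) z)"
    by (rule ennreal_term_le_suminf)
  finally show ?thesis .
qed

text \<open>Turns the decay of the kernel into integrals over balls. It is used with f = 1 for the
  mass and with f an inner oscillation integral.\<close>

lemma nn_integral_kern_le_dyadic:
  fixes x :: "'a::euclidean_space"
  assumes t: "t > 0" and [measurable]: "f \<in> borel_measurable borel"
  shows "(\<integral>\<^sup>+z. ennreal (kern t (x - z)) * f z \<partial>lborel) \<le>
    (\<Sum>k. ennreal (dyadic_weight TYPE('a) t k) * (\<integral>\<^sup>+z\<in>ball x (2 ^ k * t). f z \<partial>lborel))"
proof -
  have "(\<integral>\<^sup>+z. ennreal (kern t (x - z)) * f z \<partial>lborel) \<le>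
    (\<integral>\<^sup>+z. (\<Sum>k. ennreal (dyadic_weight TYPE('a) t k) * indicator (ball x (2 ^ k * t)) z) * f z \<partial>lborel)"
    by (intro nn_integral_mono mult_right_mono kern_le_dyadic_sum t) auto
  also have "\<dots> = (\<integral>\<^sup>+z. (\<Sum>k. ennreal (dyadic_weight TYPE('a) t k) * (f z * indicator (ball x (2 ^ k * t)) z)) \<partial>lborel)"
    by (simp add: mult_ac flip: ennreal_suminf_multc)
  also have "\<dots> = (\<Sum>k. \<integral>\<^sup>+z. ennreal (dyadic_weight TYPE('a) t k) * (f z * indicator (ball x (2 ^ k * t)) z) \<partial>lborel)"
    by (intro nn_integral_suminf borel_measurable_times_ennreal borel_measurable_indicator) auto
  also have "\<dots> = (\<Sum>k. ennreal (dyadic_weight TYPE('a) t k) * (\<integral>\<^sup>+z\<in>ball x (2 ^ k * t). f z \<partial>lborel))"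
    by (intro suminf_cong nn_integral_cmult borel_measurable_times_ennreal borel_measurable_indicator) auto
  finally show ?thesis .
qed

lemma suminf_ennreal_geometric_half:
  assumes "c \<ge> 0"
  shows "(\<Sum>k. ennreal (c * (1 / 2) ^ k)) = ennreal (2 * c)"
proof -
  have "(\<lambda>k. c * (1 / 2 :: real) ^ k) sums (c * (1 / (1 - 1 / 2)))"
    by (intro sums_mult geometric_sums) auto
  then show ?thesis
    using assms by (intro suminf_ennreal_eq) (auto simp: mult.commute)
qed

text \<open>An upper bound for the integral of \<open>kern t\<close>, uniform in t: the ball of
  index k contributes 2^(n+1) 2^(-k) times the volume of the unit ball.\<close>

definition kern_mass :: "'a::euclidean_space itself \<Rightarrow> real" where
  "kern_mass _ = 2 ^ (DIM('a) + 2) * unit_ball_vol (real DIM('a))"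

lemma kern_mass_pos: "kern_mass TYPE('a::euclidean_space) > 0"
  by (simp add: kern_mass_def)

lemma nn_integral_kern_reflect:
  fixes x :: "'a::euclidean_space"
  assumes t: "t > 0"
  shows "(\<integral>\<^sup>+z. ennreal (kern t (x - z)) \<partial>lborel) \<le> ennreal (kern_mass TYPE('a))"
proof -
  have *: "ennreal (dyadic_weight TYPE('a) t k) * emeasure lborel (ball x (2 ^ k * t)) =
     ennreal (2 ^ (DIM('a) + 1) * unit_ball_vol (real DIM('a)) * (1 / 2) ^ k)" for k
  proof -
    have "dyadic_weight TYPE('a) t k * (unit_ball_vol (real DIM('a)) * (2 ^ k * t) ^ DIM('a))
        = 2 ^ (DIM('a) + 1) * unit_ball_vol (real DIM('a)) * (1 / 2) ^ k"
      using t unfolding dyadic_weight_def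
      by (simp add: power_mult_distrib field_simps power_mult[symmetric] power_add)
    then show ?thesis
      using t dyadic_weight_nonneg[OF t, where 'a = 'a] by (subst emeasure_ball) (auto simp flip: ennreal_mult)
  qed
  have "(\<integral>\<^sup>+z. ennreal (kern t (x - z)) \<partial>lborel) \<le>
      (\<Sum>k. ennreal (dyadic_weight TYPE('a) t k) * emeasure lborel (ball x (2 ^ k * t)))"
    using nn_integral_kern_le_dyadic[OF t, of "\<lambda>_. 1" x] by simp
  also have "\<dots> = ennreal (kern_mass TYPE('a))"
    unfolding * by (subst suminf_ennreal_geometric_half) (auto simp: kern_mass_def)
  finally show ?thesis .
qed

lemma nn_integral_kern:
  assumes t: "t > 0"
  shows "(\<integral>\<^sup>+z. ennreal (kern t (z :: 'a::euclidean_space)) \<partial>lborel) \<le> ennreal (kern_mass TYPE('a))"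
  using nn_integral_kern_reflect[OF t, of "0::'a"] by simp

lemma nn_integral_kern_translate:
  fixes x :: "'a::euclidean_space"
  assumes t: "t > 0"
  shows "(\<integral>\<^sup>+z. ennreal (kern t (x + z)) \<partial>lborel) \<le> ennreal (kern_mass TYPE('a))"
  using nn_integral_kern[OF t, where 'a='a]
    nn_integral_lborel_translate[of "\<lambda>z. ennreal (kern t z)" x] by simp

text \<open>Since x = (x + h) - h, the quantity t + |x| is at most twice t + |h| or twice t + |x +
  h|. The corresponding factor is absorbed into k_t(x), and the other one remains to be integrated
  in h.\<close>

lemma kern_mult_le:
  fixes x h :: "'a::euclidean_space"
  assumes t: "t > 0"
  shows "kern t h * kern t (x + h) \<le> 2 ^ (DIM('a) + 1) * kern t x * (kern t h + kern t (x + h))"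
proof -
  have "t + norm x \<le> (t + norm h) + (t + norm (x + h))"
    using norm_triangle_ineq4[of "x + h" h] t by simp
  then have "t + norm x \<le> 2 * (t + norm (x + h))" if "\<not> t + norm x \<le> 2 * (t + norm h)"
    using that by argo
  then consider "t + norm x \<le> 2 * (t + norm h)" | "t + norm x \<le> 2 * (t + norm (x + h))"
    by blast
  then show ?thesis
  proof cases
    case 1
    have "kern t h * kern t (x + h) \<le> (2 ^ (DIM('a) + 1) * kern t x) * kern t (x + h)"
      using t 1 by (intro mult_right_mono kern_compare) auto
    also have "\<dots> \<le> (2 ^ (DIM('a) + 1) * kern t x) * (kern t h + kern t (x + h))"
      using t by (intro mult_left_mono) auto
    finally show ?thesis .
  next
    case 2
    have "kern t h * kern t (x + h) \<le> kern t h * (2 ^ (DIM('a) + 1) * kern t x)"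
      using t 2 by (intro mult_left_mono kern_compare) auto
    also have "\<dots> = (2 ^ (DIM('a) + 1) * kern t x) * kern t h"
      by simp
    also have "\<dots> \<le> (2 ^ (DIM('a) + 1) * kern t x) * (kern t h + kern t (x + h))"
      using t by (intro mult_left_mono) auto
    finally show ?thesis .
  qed
qed

definition conv_const :: "'a::euclidean_space itself \<Rightarrow> real" where
  "conv_const _ = 2 ^ (DIM('a) + 2) * kern_mass TYPE('a)"

lemma conv_const_pos: "conv_const TYPE('a::euclidean_space) > 0"
  by (simp add: conv_const_def kern_mass_pos)

lemma nn_integral_kern_convolution:
  fixes x :: "'a::euclidean_space"
  assumes t: "t > 0"
  shows "(\<integral>\<^sup>+h. ennreal (kern t h * kern t (x + h)) \<partial>lborel) \<le> ennreal (conv_const TYPE('a) * kern t x)"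
proof -
  let ?c = "2 ^ (DIM('a) + 1) * kern t x"
  have c: "?c \<ge> 0"
    using t by simp
  have "(\<integral>\<^sup>+h. ennreal (kern t h * kern t (x + h)) \<partial>lborel) \<le>
     (\<integral>\<^sup>+h. ennreal ?c * (ennreal (kern t h) + ennreal (kern t (x + h))) \<partial>lborel)"
    using t c by (intro nn_integral_mono)
      (simp add: kern_mult_le[OF t, simplified] ennreal_leI flip: ennreal_mult ennreal_plus)
  also have "\<dots> = ennreal ?c * ((\<integral>\<^sup>+h. ennreal (kern t (h :: 'a)) \<partial>lborel) + (\<integral>\<^sup>+h. ennreal (kern t (x + h)) \<partial>lborel))"
    by (subst nn_integral_cmult) (auto simp: nn_integral_add)
  also have "\<dots> \<le> ennreal ?c * (ennreal (kern_mass TYPE('a)) + ennreal (kern_mass TYPE('a)))"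
    by (intro mult_left_mono add_mono nn_integral_kern nn_integral_kern_translate t) auto
  also have "\<dots> = ennreal (conv_const TYPE('a) * kern t x)"
    using c kern_mass_pos[where 'a='a]
    by (simp add: conv_const_def less_imp_le mult_ac flip: ennreal_mult ennreal_plus)
  finally show ?thesis .
qed

text \<open>The integrand is |h|^(1-n), what remains of |h|^(-n-1) once a gradient bound has gained
  |h|^2. On the shell t/2^(k+1) < |h| <= t/2^k the numerator is bounded at the outer radius and the
  denominator at the inner one; each shell contributes a multiple of its radius.\<close>

lemma nn_integral_inner_singular:
  assumes t: "t > 0"
  shows "(\<integral>\<^sup>+h. ennreal (norm (h :: 'a::euclidean_space) ^ 2 / norm h ^ (DIM('a) + 1)) * indicator (cball 0 t) h \<partial>lborel)
    \<le> ennreal (kern_mass TYPE('a) * t)"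
proof -
  let ?N = "DIM('a)"
  let ?c = "\<lambda>k::nat. (t / 2 ^ k) ^ 2 / (t / 2 ^ Suc k) ^ (?N + 1)"
  have pointwise: "ennreal (norm h ^ 2 / norm h ^ (?N + 1)) * indicator (cball 0 t) h
     \<le> (\<Sum>k. ennreal (?c k) * indicator (cball 0 (t / 2 ^ k)) h)" for h :: 'a
  proof (cases "h \<noteq> 0 \<and> norm h \<le> t")
    case True
    then have "t / norm h \<ge> 1"
      by simp
    then obtain k where k: "2 ^ k \<le> t / norm h" "t / norm h < 2 ^ Suc k"
      by (rule dyadic_bracket)
    then have k': "norm h \<le> t / 2 ^ k" "t / 2 ^ Suc k < norm h"
      using True by (simp_all add: field_simps)
    have "norm h ^ 2 / norm h ^ (?N + 1) \<le> ?c k"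
      using k' t True by (intro frac_le power_mono) auto
    then have "ennreal (norm h ^ 2 / norm h ^ (?N + 1)) * indicator (cball 0 t) h \<le>
      ennreal (?c k) * indicator (cball 0 (t / 2 ^ k)) h"
      using True k' by (simp add: ennreal_leI)
    also have "\<dots> \<le> (\<Sum>k. ennreal (?c k) * indicator (cball 0 (t / 2 ^ k)) h)"
      by (rule ennreal_term_le_suminf)
    finally show ?thesis .
  next
    \<comment> \<open>At \<open>h = 0\<close> the quotient is 0 because its numerator vanishes; for
      |h| > t the indicator is 0.\<close>
    case False
    then show ?thesis
      by (auto simp: indicator_def)
  qed
  have *: "ennreal (?c k) * emeasure lborel (cball (0::'a) (t / 2 ^ k)) =
     ennreal (2 ^ (?N + 1) * unit_ball_vol (real ?N) * t * (1 / 2) ^ k)" for k :: nat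
  proof -
    define s where "s = t / 2 ^ k"
    have s: "s > 0"
      using t by (simp add: s_def)
    have "?c k * (unit_ball_vol (real ?N) * (t / 2 ^ k) ^ ?N) = s ^ 2 / (s / 2) ^ (?N + 1) * (unit_ball_vol (real ?N) * s ^ ?N)"
      by (simp add: s_def mult.commute)
    also have "\<dots> = 2 ^ (?N + 1) * unit_ball_vol (real ?N) * s"
      using s by (simp add: power_divide field_simps power2_eq_square)
    also have "\<dots> = 2 ^ (?N + 1) * unit_ball_vol (real ?N) * t * (1 / 2) ^ k"
      by (simp add: s_def power_one_over field_simps)
    finally show ?thesis
      using t by (subst emeasure_cball) (auto simp flip: ennreal_mult)
  qed
  have "(\<integral>\<^sup>+h. ennreal (norm (h :: 'a) ^ 2 / norm h ^ (?N + 1)) * indicator (cball 0 t) h \<partial>lborel) \<le>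
    (\<integral>\<^sup>+h. (\<Sum>k. ennreal (?c k) * indicator (cball (0::'a) (t / 2 ^ k)) h) \<partial>lborel)"
    by (intro nn_integral_mono pointwise)
  also have "\<dots> = (\<Sum>k. ennreal (?c k) * emeasure lborel (cball (0::'a) (t / 2 ^ k)))"
    by (subst nn_integral_suminf)
      (intro borel_measurable_times_ennreal borel_measurable_indicator suminf_cong nn_integral_cmult_indicator; simp)+
  also have "\<dots> = ennreal (kern_mass TYPE('a) * t)"
    unfolding * using t by (subst suminf_ennreal_geometric_half) (auto simp: kern_mass_def)
  finally show ?thesis .
qed

lemma filterlim_at_top_add_const: "filterlim f at_top F \<Longrightarrow> filterlim (\<lambda>x. f x + c :: real) at_top F"
  using filterlim_tendsto_add_at_top[OF tendsto_const[of c F] , of f] by (simp add: add.commute)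

text \<open>For t > 0 the integrand is (t + |d|)^(-n-1), with antiderivative \<open>?F\<close>. Over
  the whole half-line the integral is 1 / (n |d|^n), and this is where the weight |z - w|^(-n) comes
  from.\<close>

lemma nn_integral_kern_time:
  fixes d :: "'a::euclidean_space"
  assumes d: "d \<noteq> 0"
  shows "(\<integral>\<^sup>+t\<in>{0<..<r}. ennreal (kern t d / t) \<partial>lborel) \<le> ennreal (1 / norm d ^ DIM('a))"
proof -
  let ?N = "DIM('a)"
  let ?F = "\<lambda>t. - (1 / (real ?N * (t + norm d) ^ ?N))"
  have nd: "norm d > 0" using d by simp
  have lim: "(?F \<longlongrightarrow> - 0) at_top"
  proof (intro tendsto_minus tendsto_divide_0[OF tendsto_const] filterlim_at_top_imp_at_infinity)
    show "LIM t at_top. real ?N * (t + norm d) ^ ?N :> at_top"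
      by (intro filterlim_tendsto_pos_mult_at_top[OF tendsto_const] filterlim_pow_at_top
           filterlim_at_top_add_const) (auto intro: filterlim_ident)
  qed
  have "(\<integral>\<^sup>+t\<in>{0<..<r}. ennreal (kern t d / t) \<partial>lborel) \<le>
    (\<integral>\<^sup>+t. ennreal (1 / (t + norm d) ^ (?N + 1)) * indicator {0..} t \<partial>lborel)"
    by (intro nn_integral_mono) (auto simp: kern_def indicator_def)
  also have "\<dots> = ennreal (0 - ?F 0)"
  proof (rule nn_integral_FTC_atLeast)
    show "(?F has_real_derivative 1 / (t + norm d) ^ (?N + 1)) (at t)" if "0 \<le> t" for t :: real
    proof -
      have p: "t + norm d > 0" using that nd by linarith
      have N: "real ?N \<noteq> 0" by simp
      obtain m where m: "?N = Suc m" using not0_implies_Suc DIM_positive by blast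
      show ?thesis
        using p N unfolding m
        apply (auto intro!: derivative_eq_intros simp: divide_simps power2_eq_square)
        apply (cases m)
         apply (auto simp: algebra_simps)
        done
    qed
    show "(?F \<longlongrightarrow> 0) at_top" using lim by simp
  qed (use nd in \<open>auto intro: add_nonneg_pos\<close>)
  also have "\<dots> \<le> ennreal (1 / norm d ^ ?N)"
    using nd by (intro ennreal_leI) (auto simp: divide_simps)
  finally show ?thesis .
qed

subsection \<open>Oscillation over dyadic balls\<close>

lemma indicator_ball_measurable [measurable]:
  assumes [measurable]: "f \<in> borel_measurable M"
  shows "(\<lambda>z. indicator (ball (x :: 'a::euclidean_space) R) (f z) :: ennreal) \<in> borel_measurable M"
  by (rule measurable_compose[OF assms]) (auto intro: borel_measurable_indicator)

lemma ennreal_mult3_add: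
  assumes "p \<ge> 0" "q \<ge> 0" "u \<ge> 0" "p' \<ge> 0" "q' \<ge> 0" "u' \<ge> 0"
  shows "ennreal p * ennreal q * (ennreal u * Q) + ennreal p' * ennreal q' * (ennreal u' * Q) =
    ennreal (p * q * u + p' * q' * u') * Q"
proof -
  have "ennreal (p * q * u + p' * q' * u') = ennreal p * ennreal q * ennreal u + ennreal p' * ennreal q' * ennreal u'"
    using assms by (simp add: ennreal_mult)
  then show ?thesis
    by (simp only: distrib_right mult.assoc)
qed

text \<open>In \<open>osc_kern_le\<close> the dyadic series has first coefficient 14 * 8^n r^n and
  sum 4 times that; two terms with factor 2 each give another 4, and 14 * 4 * 4 = 224. The volume
  comes from averaging over a ball.\<close>

definition osc_const :: "'a::euclidean_space itself \<Rightarrow> real" where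
  "osc_const _ = 224 * 8 ^ DIM('a) * kern_mass TYPE('a) / unit_ball_vol (real DIM('a))"

lemma osc_const_pos: "osc_const TYPE('a::euclidean_space) > 0"
  by (simp add: osc_const_def kern_mass_pos)

text \<open>A Borel function on \<open>lborel\<close> makes the integrands jointly measurable, as
  Tonelli requires; an element of \<open>Q0_space\<close> enters through a Borel representative.
  \<open>Q\<close> plays the role of the squared seminorm.\<close>

locale Q0_bound =
  fixes a :: "'a::euclidean_space \<Rightarrow> real" and Q :: ennreal
  assumes a_measurable [measurable]: "a \<in> borel_measurable borel"
    and energy_le: "r > 0 \<Longrightarrow>
      (\<integral>\<^sup>+z\<in>ball x r. (\<integral>\<^sup>+w\<in>ball x r. ennreal ((a w - a z)\<^sup>2 / norm (w - z) ^ DIM('a)) \<partial>lborel) \<partial>lborel)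
        \<le> ennreal (r ^ DIM('a)) * Q"
begin

definition sqdiff :: "'a \<Rightarrow> 'a \<Rightarrow> ennreal" where
  "sqdiff z w = ennreal ((a z - a w)\<^sup>2)"

text \<open>Balls enter as indicators and kernels as densities, so that passing from one to the
  other is an operation on the weights alone.\<close>

definition osc :: "('a \<Rightarrow> ennreal) \<Rightarrow> ('a \<Rightarrow> ennreal) \<Rightarrow> ennreal" where
  "osc f g = (\<integral>\<^sup>+z. f z * (\<integral>\<^sup>+w. g w * sqdiff z w \<partial>lborel) \<partial>lborel)"

lemma sqdiff_measurable [measurable]:
  assumes [measurable]: "f \<in> borel_measurable M" "g \<in> borel_measurable M"
  shows "(\<lambda>x. sqdiff (f x) (g x)) \<in> borel_measurable M"
  unfolding sqdiff_def by measurable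

lemma sqdiff_commute: "sqdiff z w = sqdiff w z"
  by (simp add: sqdiff_def power2_commute)

text \<open>The pair (p, q) is a parameter: (3, 3/2) keeps the dyadic recursion below the rate 2,
  and (2, 2) suffices for the single passage from a ball to the kernel.\<close>

lemma sqdiff_triangle:
  assumes "\<And>s u :: real. (s + u)\<^sup>2 \<le> p * s\<^sup>2 + q * u\<^sup>2" "p \<ge> 0" "q \<ge> 0"
  shows "sqdiff z w \<le> ennreal p * sqdiff v z + ennreal q * sqdiff v w"
proof -
  have "(a z - a w)\<^sup>2 \<le> p * (a v - a z)\<^sup>2 + q * (a v - a w)\<^sup>2"
    using assms(1)[of "a z - a v" "a v - a w"] by (simp add: power2_commute)
  then show ?thesis
    using assms(2,3) by (simp add: sqdiff_def ennreal_leI flip: ennreal_mult ennreal_plus)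
qed

lemma osc_commute:
  assumes [measurable]: "f \<in> borel_measurable borel" "g \<in> borel_measurable borel"
  shows "osc f g = osc g f"
proof -
  have "osc f g = (\<integral>\<^sup>+z. \<integral>\<^sup>+w. f z * (g w * sqdiff z w) \<partial>lborel \<partial>lborel)"
    unfolding osc_def by (subst nn_integral_cmult) auto
  also have "\<dots> = (\<integral>\<^sup>+w. \<integral>\<^sup>+z. f z * (g w * sqdiff z w) \<partial>lborel \<partial>lborel)"
    by (rule lborel_pair.Fubini') measurable
  also have "\<dots> = (\<integral>\<^sup>+w. \<integral>\<^sup>+z. g w * (f z * sqdiff w z) \<partial>lborel \<partial>lborel)"
    by (simp add: mult_ac sqdiff_commute)
  also have "\<dots> = osc g f"
    unfolding osc_def by (subst nn_integral_cmult) auto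
  finally show ?thesis .
qed

text \<open>The triangle inequality through a third point v, averaged over v with weight h. It links
  f and g by way of their oscillations against a common h.\<close>

lemma osc_average:
  assumes [measurable]: "f \<in> borel_measurable borel" "g \<in> borel_measurable borel" "h \<in> borel_measurable borel"
    and pq: "\<And>s u :: real. (s + u)\<^sup>2 \<le> p * s\<^sup>2 + q * u\<^sup>2" "p \<ge> 0" "q \<ge> 0"
  shows "(\<integral>\<^sup>+v. h v \<partial>lborel) * osc f g \<le>
    ennreal p * (\<integral>\<^sup>+w. g w \<partial>lborel) * osc h f + ennreal q * (\<integral>\<^sup>+z. f z \<partial>lborel) * osc h g"
proof -
  let ?G = "\<integral>\<^sup>+w. g w \<partial>lborel" and ?F = "\<integral>\<^sup>+z. f z \<partial>lborel"
  have 1: "(\<integral>\<^sup>+w. g w * sqdiff z w \<partial>lborel) \<le>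
    ennreal p * ?G * sqdiff v z + ennreal q * (\<integral>\<^sup>+w. g w * sqdiff v w \<partial>lborel)" for z v
  proof -
    have "(\<integral>\<^sup>+w. g w * sqdiff z w \<partial>lborel) \<le>
      (\<integral>\<^sup>+w. ennreal p * sqdiff v z * g w + ennreal q * (g w * sqdiff v w) \<partial>lborel)"
    proof (rule nn_integral_mono)
      fix w
      have "g w * sqdiff z w \<le> g w * (ennreal p * sqdiff v z + ennreal q * sqdiff v w)"
        by (intro mult_left_mono sqdiff_triangle pq) auto
      then show "g w * sqdiff z w \<le> ennreal p * sqdiff v z * g w + ennreal q * (g w * sqdiff v w)"
        by (simp add: distrib_left mult_ac)
    qed
    also have "\<dots> = ennreal p * sqdiff v z * ?G + ennreal q * (\<integral>\<^sup>+w. g w * sqdiff v w \<partial>lborel)"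
      by (simp add: nn_integral_add nn_integral_cmult)
    finally show ?thesis
      by (simp add: mult_ac)
  qed
  have 2: "osc f g \<le> ennreal p * ?G * (\<integral>\<^sup>+z. f z * sqdiff v z \<partial>lborel) +
      ennreal q * ?F * (\<integral>\<^sup>+w. g w * sqdiff v w \<partial>lborel)" for v
  proof -
    have "osc f g \<le> (\<integral>\<^sup>+z. f z * (ennreal p * ?G * sqdiff v z + ennreal q * (\<integral>\<^sup>+w. g w * sqdiff v w \<partial>lborel)) \<partial>lborel)"
      unfolding osc_def by (intro nn_integral_mono mult_left_mono 1) auto
    also have "\<dots> = (\<integral>\<^sup>+z. ennreal p * ?G * (f z * sqdiff v z) +
        ennreal q * (\<integral>\<^sup>+w. g w * sqdiff v w \<partial>lborel) * f z \<partial>lborel)"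
      by (simp add: distrib_left mult_ac)
    also have "\<dots> = ennreal p * ?G * (\<integral>\<^sup>+z. f z * sqdiff v z \<partial>lborel) +
        ennreal q * (\<integral>\<^sup>+w. g w * sqdiff v w \<partial>lborel) * ?F"
      by (simp add: nn_integral_add nn_integral_cmult)
    finally show ?thesis
      by (simp add: mult_ac)
  qed
  have "(\<integral>\<^sup>+v. h v \<partial>lborel) * osc f g = (\<integral>\<^sup>+v. h v * osc f g \<partial>lborel)"
    by (simp add: nn_integral_multc)
  also have "\<dots> \<le> (\<integral>\<^sup>+v. h v * (ennreal p * ?G * (\<integral>\<^sup>+z. f z * sqdiff v z \<partial>lborel) +
      ennreal q * ?F * (\<integral>\<^sup>+w. g w * sqdiff v w \<partial>lborel)) \<partial>lborel)"
    by (intro nn_integral_mono mult_left_mono 2) auto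
  also have "\<dots> = (\<integral>\<^sup>+v. ennreal p * ?G * (h v * (\<integral>\<^sup>+z. f z * sqdiff v z \<partial>lborel)) +
      ennreal q * ?F * (h v * (\<integral>\<^sup>+w. g w * sqdiff v w \<partial>lborel)) \<partial>lborel)"
    by (simp add: distrib_left mult_ac)
  also have "\<dots> = ennreal p * ?G * osc h f + ennreal q * ?F * osc h g"
    unfolding osc_def by (simp add: nn_integral_add nn_integral_cmult)
  finally show ?thesis .
qed

lemma osc_mono:
  assumes "\<And>z. f z \<le> f' z" "\<And>w. g w \<le> g' w"
  shows "osc f g \<le> osc f' g'"
  unfolding osc_def using assms by (intro nn_integral_mono mult_mono) auto

lemma osc_cmult:
  assumes [measurable]: "f \<in> borel_measurable borel" "g \<in> borel_measurable borel"
  shows "osc (\<lambda>z. c * f z) g = c * osc f g"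
  unfolding osc_def by (simp add: nn_integral_cmult mult.assoc)

lemma osc_add:
  assumes [measurable]: "f \<in> borel_measurable borel" "f' \<in> borel_measurable borel" "g \<in> borel_measurable borel"
  shows "osc (\<lambda>z. f z + f' z) g = osc f g + osc f' g"
  unfolding osc_def by (simp add: nn_integral_add distrib_right)

text \<open>Two points of the ball have distance at most 2R, so that the weight |z - w|^(-n) in the
  energy is at least (2R)^(-n).\<close>

lemma osc_ball_le:
  assumes R: "R > 0"
  shows "osc (indicator (ball x R)) (indicator (ball x R)) \<le> ennreal (2 ^ DIM('a) * R ^ (2 * DIM('a))) * Q"
proof -
  let ?N = "DIM('a)"
  have 1: "indicator (ball x R) z * (indicator (ball x R) w * sqdiff z w) \<le>
     ennreal ((2 * R) ^ ?N) * (ennreal ((a w - a z)\<^sup>2 / norm (w - z) ^ ?N) * indicator (ball x R) w * indicator (ball x R) z)" for z w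
  proof (cases "z \<in> ball x R \<and> w \<in> ball x R \<and> w \<noteq> z")
    case True
    have "norm (w - z) \<le> norm (w - x) + norm (x - z)"
      using norm_triangle_ineq[of "w - x" "x - z"] by simp
    also have "\<dots> \<le> 2 * R"
      using True by (simp add: dist_norm norm_minus_commute)
    finally have "norm (w - z) ^ ?N \<le> (2 * R) ^ ?N"
      by (intro power_mono) auto
    then have "(a w - a z)\<^sup>2 * norm (w - z) ^ ?N \<le> (a w - a z)\<^sup>2 * (2 * R) ^ ?N"
      by (intro mult_left_mono) auto
    then have "(a w - a z)\<^sup>2 \<le> (2 * R) ^ ?N * ((a w - a z)\<^sup>2 / norm (w - z) ^ ?N)"
      using True by (simp add: pos_le_divide_eq mult_ac)
    then show ?thesis
      using True R by (simp add: sqdiff_def power2_commute ennreal_leI flip: ennreal_mult)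
  qed (auto simp: sqdiff_def)
  have "osc (indicator (ball x R)) (indicator (ball x R)) =
    (\<integral>\<^sup>+z. \<integral>\<^sup>+w. indicator (ball x R) z * (indicator (ball x R) w * sqdiff z w) \<partial>lborel \<partial>lborel)"
    unfolding osc_def by (subst nn_integral_cmult) auto
  also have "\<dots> \<le> (\<integral>\<^sup>+z. \<integral>\<^sup>+w. ennreal ((2 * R) ^ ?N) * (ennreal ((a w - a z)\<^sup>2 / norm (w - z) ^ ?N) *
      indicator (ball x R) w * indicator (ball x R) z) \<partial>lborel \<partial>lborel)"
    by (intro nn_integral_mono 1)
  also have "\<dots> = ennreal ((2 * R) ^ ?N) *
     (\<integral>\<^sup>+z\<in>ball x R. (\<integral>\<^sup>+w\<in>ball x R. ennreal ((a w - a z)\<^sup>2 / norm (w - z) ^ ?N) \<partial>lborel) \<partial>lborel)"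
    by (simp add: nn_integral_cmult nn_integral_multc)
  also have "\<dots> \<le> ennreal ((2 * R) ^ ?N) * (ennreal (R ^ ?N) * Q)"
    by (intro mult_left_mono energy_le R) auto
  also have "\<dots> = ennreal (2 ^ ?N * R ^ (2 * ?N)) * Q"
  proof -
    have "2 ^ ?N * R ^ (2 * ?N) = (2 * R) ^ ?N * R ^ ?N"
      by (simp only: power_mult_distrib mult_2[of ?N] power_add mult.assoc)
    then have "ennreal (2 ^ ?N * R ^ (2 * ?N)) = ennreal ((2 * R) ^ ?N) * ennreal (R ^ ?N)"
      using R by (simp add: ennreal_mult mult.assoc)
    then show ?thesis
      by (simp only: mult.assoc)
  qed
  finally show ?thesis .
qed

text \<open>
  The sequence \<open>c\<^sub>k = 7 (3/2)^k - 6\<close> solves \<open>c\<^sub>k\<^sub>+\<^sub>1 = 3/2 c\<^sub>k + 3\<close>, the recursion that comes from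
  \<open>(s + u)\<^sup>2 \<le> 3 s\<^sup>2 + 3/2 u\<^sup>2\<close>. The rate \<open>3/2\<close> only has to be smaller than 2: the tail of the kernel
  contributes a factor \<open>2^(-k)\<close> on the ball of radius \<open>2^k r\<close>.
\<close>
lemma osc_dyadic_le:
  assumes r: "r > 0"
  shows "osc (indicator (ball x (2 ^ k * r))) (indicator (ball x r)) \<le>
    ennreal ((2 ^ k) ^ DIM('a) * r ^ (2 * DIM('a)) * 4 ^ DIM('a) * (7 * (3 / 2) ^ k - 6)) * Q"
proof (induction k)
  case 0
  \<comment> \<open>Here \<open>7 * (3 / 2) ^ 0 - 6\<close> is 1. The factor 2^n of
    \<open>osc_ball_le\<close> is enlarged to the 4^n that the recursion reproduces.\<close>
  have "(2::real) ^ DIM('a) \<le> 4 ^ DIM('a)"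
    by (intro power_mono) auto
  then have "ennreal (2 ^ DIM('a) * r ^ (2 * DIM('a))) * Q \<le> ennreal (r ^ (2 * DIM('a)) * 4 ^ DIM('a)) * Q"
    using r by (intro mult_right_mono ennreal_leI) (auto simp: mult.commute)
  then show ?case
    using osc_ball_le[OF r, of x] by (auto intro: order_trans)
next
  case (Suc k)
  let ?N = "DIM('a)"
  let ?b = "\<lambda>k::nat. (indicator (ball x (2 ^ k * r)) :: 'a \<Rightarrow> ennreal)"
  let ?B = "indicator (ball x r) :: 'a \<Rightarrow> ennreal"
  define \<omega> where "\<omega> = unit_ball_vol (real ?N)"
  define A where "A = (2 ^ k) ^ ?N * r ^ ?N"
  define c where "c = 7 * (3 / 2 :: real) ^ k - 6"
  have \<omega>: "\<omega> > 0" by (simp add: \<omega>_def)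
  have A: "A > 0" using r by (simp add: A_def)
  have c: "c \<ge> 0"
    using one_le_power[of "3 / 2 :: real" k] unfolding c_def by linarith
  have int: "(\<integral>\<^sup>+v. ?b k v \<partial>lborel) = ennreal (\<omega> * A)"
       "(\<integral>\<^sup>+v. ?B v \<partial>lborel) = ennreal (\<omega> * r ^ ?N)"
       "(\<integral>\<^sup>+v. ?b (Suc k) v \<partial>lborel) = ennreal (\<omega> * (2 ^ ?N * A))"
    using r by (simp_all add: emeasure_ball \<omega>_def A_def power_mult_distrib del: power_Suc)
      (simp add: power_mult_distrib)
  have sub: "ball x (2 ^ k * r) \<subseteq> ball x (2 ^ Suc k * r)"
    using r by (intro subset_ball) auto
  have sq: "(s + u)\<^sup>2 \<le> 3 * s\<^sup>2 + 3 / 2 * u\<^sup>2" for s u :: real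
    using zero_le_power2[of "2 * s - u"] by (simp add: power2_eq_square algebra_simps)
  \<comment> \<open>The intermediate weight is the ball of radius 2^k r. The large factor 3 goes to
    the pair of consecutive balls, which \<open>osc_ball_le\<close> controls on the larger one; the
    small factor 3/2 goes to the induction hypothesis. After division by the mass of the
    intermediate ball these become the 3 and the 3/2 of the recursion.\<close>
  have "ennreal (\<omega> * A) * osc (?b (Suc k)) ?B \<le>
     ennreal 3 * ennreal (\<omega> * r ^ ?N) * osc (?b k) (?b (Suc k)) +
     ennreal (3 / 2) * ennreal (\<omega> * (2 ^ ?N * A)) * osc (?b k) ?B"
    using osc_average[of "?b (Suc k)" ?B "?b k" 3 "3/2"] sq unfolding int by simp
  also have "\<dots> \<le>
     ennreal 3 * ennreal (\<omega> * r ^ ?N) * (ennreal (2 ^ ?N * (2 ^ Suc k * r) ^ (2 * ?N)) * Q) +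
     ennreal (3 / 2) * ennreal (\<omega> * (2 ^ ?N * A)) *
       (ennreal ((2 ^ k) ^ ?N * r ^ (2 * ?N) * 4 ^ ?N * c) * Q)"
  proof (intro add_mono mult_left_mono)
    have "osc (?b k) (?b (Suc k)) \<le> osc (?b (Suc k)) (?b (Suc k))"
      using sub by (intro osc_mono) (auto simp: indicator_def)
    also have "\<dots> \<le> ennreal (2 ^ ?N * (2 ^ Suc k * r) ^ (2 * ?N)) * Q"
      using r by (intro osc_ball_le) auto
    finally show "osc (?b k) (?b (Suc k)) \<le> ennreal (2 ^ ?N * (2 ^ Suc k * r) ^ (2 * ?N)) * Q" .
  qed (use Suc.IH in \<open>auto simp: c_def\<close>)
  also have "\<dots> = ennreal (3 * (\<omega> * r ^ ?N) * (2 ^ ?N * (2 ^ Suc k * r) ^ (2 * ?N)) +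
      3 / 2 * (\<omega> * (2 ^ ?N * A)) * ((2 ^ k) ^ ?N * r ^ (2 * ?N) * 4 ^ ?N * c)) * Q"
    using r \<omega> A c by (intro ennreal_mult3_add) auto
  also have "\<dots> = ennreal (\<omega> * A) * (ennreal ((2 ^ Suc k) ^ ?N * r ^ (2 * ?N) * 4 ^ ?N * (7 * (3 / 2) ^ Suc k - 6)) * Q)"
  proof -
    have 4: "(4::real) ^ ?N = 2 ^ ?N * 2 ^ ?N"
      using power_mult_distrib[of "2::real" 2 ?N] by simp
    \<comment> \<open>With s = r^n, e = 2^n, p = (2^k)^n, q = 2^k and X = (3/2)^k the recursion
      becomes a polynomial identity.\<close>
    have gen: "3 * (\<omega> * s) * (e * ((2 * q)\<^sup>2 ^ ?N * s\<^sup>2)) + 3 / 2 * (\<omega> * (e * (p * s))) * (p * s\<^sup>2 * (e * e) * (7 * X - 6))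
       = \<omega> * (p * s) * ((e * p) * s\<^sup>2 * (e * e) * (7 * (3 / 2 * X) - 6))"
      if "(2 * q)\<^sup>2 ^ ?N = (e * p)\<^sup>2" for s e p q X :: real
      unfolding that by (simp add: power2_eq_square algebra_simps)
    have "3 * (\<omega> * r ^ ?N) * (2 ^ ?N * (2 ^ Suc k * r) ^ (2 * ?N)) +
      3 / 2 * (\<omega> * (2 ^ ?N * A)) * ((2 ^ k) ^ ?N * r ^ (2 * ?N) * 4 ^ ?N * c) =
      (\<omega> * A) * ((2 ^ Suc k) ^ ?N * r ^ (2 * ?N) * 4 ^ ?N * (7 * (3 / 2) ^ Suc k - 6))"
    proof -
      have "(2 * 2 ^ k :: real)\<^sup>2 ^ ?N = (2 ^ ?N * (2 ^ k) ^ ?N)\<^sup>2"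
        by (simp only: power_mult_distrib power_commutes flip: power_mult) (simp add: mult.commute)
      note gen[OF this, of "r ^ ?N" "(3 / 2) ^ k"]
      moreover have "r ^ (2 * ?N) = (r ^ ?N)\<^sup>2" "(2 * 2 ^ k * r) ^ (2 * ?N) = (2 * 2 ^ k)\<^sup>2 ^ ?N * (r ^ ?N)\<^sup>2"
        by (simp_all only: power_mult_distrib power_mult) (simp_all add: mult.commute flip: power_mult)
      moreover have "(2 * 2 ^ k :: real) ^ ?N = 2 ^ ?N * (2 ^ k) ^ ?N"
        by (rule power_mult_distrib)
      ultimately show ?thesis
        unfolding A_def c_def 4 power_Suc by (simp only:)
    qed
    then show ?thesis
      using \<omega> A by (simp add: ennreal_mult' mult.assoc del: power_Suc)
  qed
  finally show ?case
    using \<omega> A by (subst (asm) ennreal_mult_le_mult_iff) auto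
qed

text \<open>First one weight is the kernel and the other the ball of radius r: a dyadic weight of
  order 2^(-(n+1)k) meets an oscillation of order 2^(nk) (3/2)^k, which leaves (3/4)^k. Then
  averaging over the same ball puts the kernel in both slots.\<close>

lemma osc_kern_le:
  assumes r: "r > 0"
  shows "osc (\<lambda>z. ennreal (kern r (x - z))) (\<lambda>z. ennreal (kern r (x - z))) \<le> ennreal (osc_const TYPE('a)) * Q"
proof -
  let ?N = "DIM('a)"
  let ?K = "\<lambda>z. ennreal (kern r (x - z))"
  let ?B = "indicator (ball x r) :: 'a \<Rightarrow> ennreal"
  define \<omega> where "\<omega> = unit_ball_vol (real ?N)"
  define m where "m = kern_mass TYPE('a)"
  have \<omega>: "\<omega> > 0" by (simp add: \<omega>_def)
  have m: "m > 0" by (simp add: m_def kern_mass_pos)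
  \<comment> \<open>14 * 8^n is the 2^(n+1) of \<open>dyadic_weight\<close> times the 7 * 4^n of
    \<open>osc_dyadic_le\<close>, whose term -6 is dropped.\<close>
  define d where "d = 14 * 8 ^ ?N * r ^ ?N"
  have d: "d \<ge> 0" using r by (simp add: d_def)
  have geom: "(\<Sum>k. ennreal (d * (3 / 4) ^ k)) = ennreal (4 * d)"
  proof -
    have "(\<lambda>k. d * (3 / 4 :: real) ^ k) sums (d * (1 / (1 - 3 / 4)))"
      by (intro sums_mult geometric_sums) auto
    then show ?thesis
      using d by (intro suminf_ennreal_eq) (auto simp: mult.commute)
  qed
  have step: "ennreal (dyadic_weight TYPE('a) r k) * osc (indicator (ball x (2 ^ k * r))) ?B \<le> ennreal (d * (3 / 4) ^ k) * Q" for k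
  proof -
    have "ennreal (dyadic_weight TYPE('a) r k) * osc (indicator (ball x (2 ^ k * r))) ?B \<le>
      ennreal (dyadic_weight TYPE('a) r k) * (ennreal ((2 ^ k) ^ ?N * r ^ (2 * ?N) * 4 ^ ?N * (7 * (3 / 2) ^ k)) * Q)"
      using r by (intro mult_left_mono order_trans[OF osc_dyadic_le[OF r]] mult_right_mono ennreal_leI) auto
    also have "\<dots> = ennreal (dyadic_weight TYPE('a) r k * ((2 ^ k) ^ ?N * r ^ (2 * ?N) * 4 ^ ?N * (7 * (3 / 2) ^ k))) * Q"
      using r dyadic_weight_nonneg[OF r, where 'a='a] by (simp add: ennreal_mult mult.assoc)
    also have "dyadic_weight TYPE('a) r k * ((2 ^ k) ^ ?N * r ^ (2 * ?N) * 4 ^ ?N * (7 * (3 / 2) ^ k)) = d * (3 / 4) ^ k"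
    proof -
      have 8: "(8::real) ^ ?N = 2 ^ ?N * 4 ^ ?N"
        using power_mult_distrib[of "2::real" 4 ?N] by simp
      have 34: "(3 / 4 :: real) ^ k = (3 / 2) ^ k / 2 ^ k"
        using power_divide[of "3 / 2 :: real" 2 k] by simp
      have 2: "((2::real) ^ (?N + 1)) ^ k = (2 ^ k) ^ ?N * 2 ^ k"
        using power_mult_distrib[of "2 ^ ?N :: real" 2 k] power_mult[of "2::real" ?N k] power_mult[of "2::real" k ?N]
        by (simp add: mult.commute)
      have *: "e / (p * q) / s * (p * (s * s) * f * (7 * X)) = 7 * e * f * s * (X / q)"
        if "p > 0" "q > 0" "s > 0" for e p q s f X :: real
        using that by (simp add: field_simps)
      have rr: "r ^ (2 * ?N) = r ^ ?N * r ^ ?N"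
        by (simp add: mult_2 power_add)
      show ?thesis
        unfolding d_def dyadic_weight_def 8 34 2 rr
        by (subst *) (use r in auto)
    qed
    finally show ?thesis .
  qed
  \<comment> \<open>\<open>osc_average\<close> puts the ball first, while the dyadic majorant acts
    on the outer integral.\<close>
  have "osc ?B ?K = osc ?K ?B"
    by (rule osc_commute) auto
  also have "\<dots> \<le> (\<Sum>k. ennreal (dyadic_weight TYPE('a) r k) *
      (\<integral>\<^sup>+z\<in>ball x (2 ^ k * r). (\<integral>\<^sup>+w. ?B w * sqdiff z w \<partial>lborel) \<partial>lborel))"
    unfolding osc_def by (intro nn_integral_kern_le_dyadic r) auto
  also have "\<dots> = (\<Sum>k. ennreal (dyadic_weight TYPE('a) r k) * osc (indicator (ball x (2 ^ k * r))) ?B)"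
    unfolding osc_def by (simp add: mult.commute)
  also have "\<dots> \<le> (\<Sum>k. ennreal (d * (3 / 4) ^ k) * Q)"
    by (intro suminf_le step) auto
  also have "\<dots> = ennreal (4 * d) * Q"
    by (simp only: ennreal_suminf_multc geom)
  finally have BK: "osc ?B ?K \<le> ennreal (4 * d) * Q" .
  have sq: "(s + u)\<^sup>2 \<le> 2 * s\<^sup>2 + 2 * u\<^sup>2" for s u :: real
    using zero_le_power2[of "s - u"] by (simp add: power2_eq_square algebra_simps)
  have B: "(\<integral>\<^sup>+v. ?B v \<partial>lborel) = ennreal (\<omega> * r ^ ?N)"
    using r by (simp add: emeasure_ball \<omega>_def)
  have "ennreal (\<omega> * r ^ ?N) * osc ?K ?K \<le>
     ennreal 2 * (\<integral>\<^sup>+w. ?K w \<partial>lborel) * osc ?B ?K + ennreal 2 * (\<integral>\<^sup>+w. ?K w \<partial>lborel) * osc ?B ?K"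
    using osc_average[of ?K ?K ?B 2 2] sq unfolding B by simp
  also have "\<dots> \<le> ennreal 2 * ennreal m * (ennreal (4 * d) * Q) + ennreal 2 * ennreal m * (ennreal (4 * d) * Q)"
    unfolding m_def by (intro add_mono mult_mono BK nn_integral_kern_reflect r) auto
  also have "\<dots> = ennreal (16 * m * d) * Q"
  proof -
    have "ennreal 2 * ennreal m * (ennreal (4 * d) * Q) + ennreal 2 * ennreal m * (ennreal (4 * d) * Q) =
        ennreal (2 * m * (4 * d) + 2 * m * (4 * d)) * Q"
      using m d by (intro ennreal_mult3_add) auto
    then show ?thesis
      by (simp add: mult_ac)
  qed
  also have "\<dots> = ennreal (\<omega> * r ^ ?N) * (ennreal (osc_const TYPE('a)) * Q)"
  proof -
    have *: "16 * m * d = (\<omega> * r ^ ?N) * osc_const TYPE('a)"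
      using less_imp_neq[OF \<omega>] unfolding d_def osc_const_def m_def \<omega>_def by simp
    show ?thesis
      unfolding * using \<omega> r by (simp add: ennreal_mult' mult.assoc)
  qed
  finally show ?thesis
    using \<omega> r by (subst (asm) ennreal_mult_le_mult_iff) auto
qed

end

subsection \<open>The Carleson estimate\<close>

text \<open>Tonelli twice, moving the outermost variable innermost. That variable has a type of its
  own because it is a point of the space in some uses and the time t in another.\<close>

lemma nn_integral_lborel_rotate:
  fixes F :: "'b::euclidean_space \<Rightarrow> 'a::euclidean_space \<Rightarrow> 'a \<Rightarrow> ennreal"
  assumes F: "(\<lambda>(y, z, w). F y z w) \<in> borel_measurable (borel \<Otimes>\<^sub>M borel \<Otimes>\<^sub>M borel)"
  shows "(\<integral>\<^sup>+y. \<integral>\<^sup>+z. \<integral>\<^sup>+w. F y z w \<partial>lborel \<partial>lborel \<partial>lborel) =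
    (\<integral>\<^sup>+z. \<integral>\<^sup>+w. \<integral>\<^sup>+y. F y z w \<partial>lborel \<partial>lborel \<partial>lborel)"
proof -
  have [measurable]: "(\<lambda>x. F (f x) (g x) (h x)) \<in> borel_measurable M"
    if [measurable]: "f \<in> borel_measurable M" "g \<in> borel_measurable M" "h \<in> borel_measurable M" for f g h and M :: "'c measure"
    using measurable_compose[OF _ F, of "\<lambda>x. (f x, g x, h x)" M] by simp
  have "(\<integral>\<^sup>+y. \<integral>\<^sup>+z. \<integral>\<^sup>+w. F y z w \<partial>lborel \<partial>lborel \<partial>lborel) =
      (\<integral>\<^sup>+z. \<integral>\<^sup>+y. \<integral>\<^sup>+w. F y z w \<partial>lborel \<partial>lborel \<partial>lborel)"
    by (rule lborel_pair.Fubini') measurable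
  also have "\<dots> = (\<integral>\<^sup>+z. \<integral>\<^sup>+w. \<integral>\<^sup>+y. F y z w \<partial>lborel \<partial>lborel \<partial>lborel)"
    by (intro nn_integral_cong lborel_pair.Fubini') measurable
  finally show ?thesis .
qed

text \<open>Here |y - z| >= r, hence r + |x - z| <= 2r + |y - z| <= 3 |y - z|. The numerators t and
  r of the two kernels account for the factor t/r, which later cancels 1/t.\<close>

lemma kern_far_le:
  fixes x y z :: "'a::euclidean_space"
  assumes "0 < t" "t < r" "y \<in> ball x r" "z \<notin> ball x (2 * r)"
  shows "kern t (y - z) \<le> 3 ^ (DIM('a) + 1) * (t / r) * kern r (x - z)"
proof -
  let ?N = "DIM('a)"
  have r: "r > 0"
    using assms by simp
  have "norm (x - z) \<le> norm (x - y) + norm (y - z)"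
    using norm_triangle_ineq[of "x - y" "y - z"] by simp
  then have "r + norm (x - z) \<le> 3 * norm (y - z)"
    using assms by (simp add: dist_norm)
  then have le: "r + norm (x - z) \<le> 3 * (t + norm (y - z))"
    using assms by simp
  have pos: "0 < r + norm (x - z)" "0 < t + norm (y - z)"
    using r assms(1) by (simp_all add: add_pos_nonneg)
  have "(r + norm (x - z)) ^ (?N + 1) \<le> 3 ^ (?N + 1) * (t + norm (y - z)) ^ (?N + 1)"
    using power_mono[OF le, of "?N + 1"] pos(1) by (simp only: power_mult_distrib less_imp_le)
  moreover have "t / q \<le> C * (t / r) * (r / p)" if "p \<le> C * q" "0 < p" "0 < q" for p q C :: real
    using that assms(1) r by (simp add: field_simps)
  ultimately show ?thesis
    unfolding kern_def using pos zero_less_power by blast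
qed

text \<open>If w lies in the ball of radius 2r, then r^n k_r(x - w) is at least 3^(-n-1), so that
  the full mass of the kernel is an admissible bound. Otherwise \<open>kern_far_le\<close> with t/r
  <= 1 is multiplied by the volume of the ball.\<close>

lemma nn_integral_kern_ball_le:
  fixes x w :: "'a::euclidean_space"
  assumes t: "0 < t" "t < r"
  shows "(\<integral>\<^sup>+y\<in>ball x r. ennreal (kern t (y - w)) \<partial>lborel) \<le>
    ennreal (3 ^ (DIM('a) + 1) * kern_mass TYPE('a) * r ^ DIM('a) * kern r (x - w))"
proof (cases "w \<in> ball x (2 * r)")
  case True
  let ?N = "DIM('a)"
  have r: "r > 0"
    using t by simp
  have "(\<integral>\<^sup>+y\<in>ball x r. ennreal (kern t (y - w)) \<partial>lborel) \<le> (\<integral>\<^sup>+y. ennreal (kern t (w - y)) \<partial>lborel)"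
    by (intro nn_integral_mono) (auto simp: indicator_def kern_minus_commute)
  also have "\<dots> \<le> ennreal (kern_mass TYPE('a))"
    by (rule nn_integral_kern_reflect) (rule t)
  also have "\<dots> \<le> ennreal (3 ^ (?N + 1) * kern_mass TYPE('a) * r ^ ?N * kern r (x - w))"
  proof (rule ennreal_leI)
    have "r + norm (x - w) \<le> 3 * r"
      using True by (simp add: dist_norm)
    then have "(r + norm (x - w)) ^ (?N + 1) \<le> (3 * r) ^ (?N + 1)"
      using r by (intro power_mono) auto
    then have "(r + norm (x - w)) ^ (?N + 1) \<le> 3 ^ (?N + 1) * (r ^ ?N * r)"
      by (simp only: power_mult_distrib) (simp add: mult_ac)
    moreover have "0 < (r + norm (x - w)) ^ (?N + 1)"
      using r by (simp add: add_pos_nonneg)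
    moreover have "1 \<le> C * s * (r / p)" if "p \<le> C * (s * r)" "0 < p" for p C s :: real
      using that by (simp add: field_simps)
    ultimately have "1 \<le> 3 ^ (?N + 1) * r ^ ?N * kern r (x - w)"
      unfolding kern_def by blast
    then show "kern_mass TYPE('a) \<le> 3 ^ (?N + 1) * kern_mass TYPE('a) * r ^ ?N * kern r (x - w)"
      using mult_left_mono[of 1 "3 ^ (?N + 1) * r ^ ?N * kern r (x - w)" "kern_mass TYPE('a)"]
        kern_mass_pos[where 'a='a] by (simp add: mult_ac)
  qed
  finally show ?thesis .
next
  case False
  let ?N = "DIM('a)"
  let ?C = "3 ^ (?N + 1) * kern r (x - w)"
  have r: "r > 0"
    using t by simp
  have C: "?C \<ge> 0"
    using r by simp
  have "kern t (y - w) \<le> ?C" if "y \<in> ball x r" for y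
  proof -
    have "kern t (y - w) \<le> 3 ^ (?N + 1) * (t / r) * kern r (x - w)"
      using t that False by (rule kern_far_le)
    also have "\<dots> = (t / r) * ?C"
      by simp
    also have "\<dots> \<le> 1 * ?C"
      using t r C by (intro mult_right_mono) auto
    finally show ?thesis
      by simp
  qed
  then have "(\<integral>\<^sup>+y\<in>ball x r. ennreal (kern t (y - w)) \<partial>lborel) \<le> (\<integral>\<^sup>+y. ennreal ?C * indicator (ball x r) y \<partial>lborel)"
    by (intro nn_integral_mono) (auto simp: indicator_def intro: ennreal_leI)
  also have "\<dots> = ennreal (?C * (unit_ball_vol (real ?N) * r ^ ?N))"
    using r C by (simp add: nn_integral_cmult_indicator emeasure_ball flip: ennreal_mult)
  also have "\<dots> \<le> ennreal (?C * (kern_mass TYPE('a) * r ^ ?N))"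
  proof -
    have "unit_ball_vol (real ?N) \<le> kern_mass TYPE('a)"
      using mult_right_mono[OF one_le_power[of "2::real" "?N + 2"], of "unit_ball_vol (real ?N)"]
      by (simp add: kern_mass_def)
    then show ?thesis
      using r C by (intro ennreal_leI mult_left_mono mult_right_mono) auto
  qed
  finally show ?thesis
    by (simp add: mult_ac)
qed

lemma nn_integral_kern_mult_le:
  fixes z w :: "'a::euclidean_space"
  assumes t: "t > 0"
  shows "(\<integral>\<^sup>+y. ennreal (kern t (y - z)) * ennreal (kern t (y - w)) \<partial>lborel) \<le>
    ennreal (conv_const TYPE('a) * kern t (w - z))"
proof -
  have "(\<integral>\<^sup>+y. ennreal (kern t (y - z)) * ennreal (kern t (y - w)) \<partial>lborel) =
    (\<integral>\<^sup>+h. ennreal (kern t (z + h - z)) * ennreal (kern t (z + h - w)) \<partial>lborel)"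
    by (rule nn_integral_lborel_translate[symmetric]) auto
  also have "\<dots> = (\<integral>\<^sup>+h. ennreal (kern t h * kern t ((z - w) + h)) \<partial>lborel)"
    using t by (intro nn_integral_cong) (simp add: algebra_simps flip: ennreal_mult)
  also have "\<dots> \<le> ennreal (conv_const TYPE('a) * kern t (z - w))"
    by (rule nn_integral_kern_convolution) (rule t)
  finally show ?thesis
    by (simp add: kern_minus_commute)
qed

text \<open>One far point is enough: its kernel yields t/r pointwise, and the other kernel is
  integrated over the ball with no further gain. Each of the two contributes one factor 3^(n+1),
  hence the square in \<open>C\<close>. If both points are near, y may run over the whole space and
  the convolution bound applies.\<close>

lemma nn_integral_kern_mult_ball_le:
  fixes x z w :: "'a::euclidean_space"
  assumes t: "0 < t" "t < r"
  defines "C \<equiv> (3 ^ (DIM('a) + 1))\<^sup>2 * kern_mass TYPE('a)"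
  shows "(\<integral>\<^sup>+y\<in>ball x r. ennreal (kern t (y - z)) * ennreal (kern t (y - w)) \<partial>lborel) \<le>
    ennreal (conv_const TYPE('a) * kern t (w - z)) * indicator (ball x (2 * r)) w * indicator (ball x (2 * r)) z +
    ennreal (C * (t / r) * r ^ DIM('a)) * (ennreal (kern r (x - z)) * ennreal (kern r (x - w)))"
    (is "?I z w \<le> _ + ?F z w")
proof -
  have r: "r > 0"
    using t by simp
  have far: "?I z w \<le> ?F z w" if "z \<notin> ball x (2 * r)" for z w
  proof -
    let ?c = "3 ^ (DIM('a) + 1) * (t / r) * kern r (x - z)"
    have c: "?c \<ge> 0"
      using t r by simp
    have "?I z w \<le> (\<integral>\<^sup>+y. ennreal ?c * (ennreal (kern t (y - w)) * indicator (ball x r) y) \<partial>lborel)"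
      using kern_far_le[OF t _ that]
      by (intro nn_integral_mono) (auto simp: indicator_def intro!: mult_right_mono ennreal_leI)
    also have "\<dots> = ennreal ?c * (\<integral>\<^sup>+y\<in>ball x r. ennreal (kern t (y - w)) \<partial>lborel)"
      by (rule nn_integral_cmult) auto
    also have "\<dots> \<le> ennreal ?c * ennreal (3 ^ (DIM('a) + 1) * kern_mass TYPE('a) * r ^ DIM('a) * kern r (x - w))"
      by (intro mult_left_mono nn_integral_kern_ball_le t) auto
    also have "\<dots> = ennreal (?c * (3 ^ (DIM('a) + 1) * kern_mass TYPE('a) * r ^ DIM('a) * kern r (x - w)))"
      by (rule ennreal_mult'[OF c, symmetric])
    also have "?c * (3 ^ (DIM('a) + 1) * kern_mass TYPE('a) * r ^ DIM('a) * kern r (x - w)) =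
        (C * (t / r) * r ^ DIM('a)) * (kern r (x - z) * kern r (x - w))"
      unfolding C_def power2_eq_square by (simp only: mult_ac)
    also have "ennreal ((C * (t / r) * r ^ DIM('a)) * (kern r (x - z) * kern r (x - w))) = ?F z w"
    proof -
      have "ennreal (b * (k * l)) = ennreal b * (ennreal k * ennreal l)" if "0 \<le> b" "0 \<le> k" for b k l
        using that by (simp add: ennreal_mult')
      moreover have "0 \<le> C * (t / r) * r ^ DIM('a)"
        using r t kern_mass_pos[where 'a='a] by (simp add: C_def)
      ultimately show ?thesis
        using kern_nonneg[of r "x - z"] r less_imp_le by blast
    qed
    finally show ?thesis .
  qed
  consider "z \<notin> ball x (2 * r)" | "w \<notin> ball x (2 * r)" | "z \<in> ball x (2 * r)" "w \<in> ball x (2 * r)"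
    by blast
  then show ?thesis
  proof cases
    case 1
    then show ?thesis
      using far[of z w] by (auto intro: order_trans)
  next
    case 2
    then have "?I w z \<le> ?F w z"
      by (rule far)
    then have "?I z w \<le> ?F z w"
      by (simp add: mult_ac)
    then show ?thesis
      by (auto intro: order_trans)
  next
    case 3
    have "?I z w \<le> (\<integral>\<^sup>+y. ennreal (kern t (y - z)) * ennreal (kern t (y - w)) \<partial>lborel)"
      by (intro nn_integral_mono) (auto simp: indicator_def)
    also have "\<dots> \<le> ennreal (conv_const TYPE('a) * kern t (w - z))"
      by (rule nn_integral_kern_mult_le) (rule t)
    also have "\<dots> = ennreal (conv_const TYPE('a) * kern t (w - z)) * indicator (ball x (2 * r)) w * indicator (ball x (2 * r)) z"
      using 3 by simp
    finally show ?thesis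
      by (rule order_trans) simp
  qed
qed

definition carleson_const :: "'a::euclidean_space itself \<Rightarrow> real" where
  "carleson_const _ = conv_const TYPE('a) * 2 ^ DIM('a) + (3 ^ (DIM('a) + 1))\<^sup>2 * kern_mass TYPE('a) * osc_const TYPE('a)"

lemma carleson_const_pos: "carleson_const TYPE('a::euclidean_space) > 0"
  by (simp add: carleson_const_def conv_const_pos kern_mass_pos osc_const_pos add_pos_pos)

context Q0_bound
begin

text \<open>This is \<open>V\<^sub>t(y)\<close> of the overview.\<close>

definition kern_osc :: "real \<Rightarrow> 'a \<Rightarrow> ennreal" where
  "kern_osc t y = osc (\<lambda>z. ennreal (kern t (y - z))) (\<lambda>z. ennreal (kern t (y - z)))"

lemma kern_osc_le: "r > 0 \<Longrightarrow> kern_osc r x \<le> ennreal (osc_const TYPE('a)) * Q"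
  unfolding kern_osc_def by (rule osc_kern_le)

lemma kern_osc_measurable [measurable]:
  assumes [measurable]: "f \<in> borel_measurable M" "g \<in> borel_measurable M"
  shows "(\<lambda>x. kern_osc (f x) (g x)) \<in> borel_measurable M"
  unfolding kern_osc_def osc_def by measurable

lemma kern_osc_eq:
  "kern_osc t y = (\<integral>\<^sup>+z. \<integral>\<^sup>+w. ennreal (kern t (y - z)) * ennreal (kern t (y - w)) * sqdiff z w \<partial>lborel \<partial>lborel)"
  unfolding kern_osc_def osc_def by (simp add: nn_integral_cmult mult.assoc)

lemma nn_integral_kern_osc_ball:
  assumes t: "0 < t" "t < r"
  shows "(\<integral>\<^sup>+y\<in>ball x r. kern_osc t y \<partial>lborel) \<le>
    (\<integral>\<^sup>+z. \<integral>\<^sup>+w. ennreal (conv_const TYPE('a) * kern t (w - z)) *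
        (indicator (ball x (2 * r)) w * indicator (ball x (2 * r)) z * sqdiff z w) \<partial>lborel \<partial>lborel) +
    ennreal ((3 ^ (DIM('a) + 1))\<^sup>2 * kern_mass TYPE('a) * (t / r) * r ^ DIM('a)) * kern_osc r x"
    (is "_ \<le> ?near + ennreal ?C * _")
proof -
  have "(\<integral>\<^sup>+y\<in>ball x r. kern_osc t y \<partial>lborel) =
    (\<integral>\<^sup>+y. \<integral>\<^sup>+z. \<integral>\<^sup>+w. ennreal (kern t (y - z)) * ennreal (kern t (y - w)) * indicator (ball x r) y * sqdiff z w \<partial>lborel \<partial>lborel \<partial>lborel)"
    unfolding kern_osc_eq by (subst nn_integral_multc[symmetric], measurable)+ (simp add: mult_ac)
  also have "\<dots> = (\<integral>\<^sup>+z. \<integral>\<^sup>+w. \<integral>\<^sup>+y. ennreal (kern t (y - z)) * ennreal (kern t (y - w)) * indicator (ball x r) y * sqdiff z w \<partial>lborel \<partial>lborel \<partial>lborel)"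
    by (rule nn_integral_lborel_rotate) measurable
  also have "\<dots> = (\<integral>\<^sup>+z. \<integral>\<^sup>+w. (\<integral>\<^sup>+y\<in>ball x r. ennreal (kern t (y - z)) * ennreal (kern t (y - w)) \<partial>lborel) * sqdiff z w \<partial>lborel \<partial>lborel)"
    by (simp add: nn_integral_multc)
  also have "\<dots> \<le> (\<integral>\<^sup>+z. \<integral>\<^sup>+w. (ennreal (conv_const TYPE('a) * kern t (w - z)) * indicator (ball x (2 * r)) w * indicator (ball x (2 * r)) z +
    ennreal ?C * (ennreal (kern r (x - z)) * ennreal (kern r (x - w)))) * sqdiff z w \<partial>lborel \<partial>lborel)"
    by (intro nn_integral_mono mult_right_mono nn_integral_kern_mult_ball_le t) auto
  also have "\<dots> = (\<integral>\<^sup>+z. \<integral>\<^sup>+w. ennreal (conv_const TYPE('a) * kern t (w - z)) * (indicator (ball x (2 * r)) w * indicator (ball x (2 * r)) z * sqdiff z w) +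
    ennreal ?C * (ennreal (kern r (x - z)) * ennreal (kern r (x - w)) * sqdiff z w) \<partial>lborel \<partial>lborel)"
    by (simp only: distrib_right mult.assoc)
  also have "\<dots> = ?near + ennreal ?C * kern_osc r x"
    unfolding kern_osc_eq by (simp add: nn_integral_add nn_integral_cmult)
  finally show ?thesis .
qed

lemma carleson_estimate:
  assumes r: "r > 0"
  shows "(\<integral>\<^sup>+t\<in>{0<..<r}. ennreal (1 / t) * (\<integral>\<^sup>+y\<in>ball x r. kern_osc t y \<partial>lborel) \<partial>lborel) \<le>
    ennreal (carleson_const TYPE('a) * r ^ DIM('a)) * Q"
proof -
  let ?N = "DIM('a)"
  let ?E = "\<lambda>z w. indicator (ball x (2 * r)) w * indicator (ball x (2 * r)) z * sqdiff z w"
  let ?D = "\<lambda>t. \<integral>\<^sup>+z. \<integral>\<^sup>+w. ennreal (conv_const TYPE('a) * kern t (w - z)) * ?E z w \<partial>lborel \<partial>lborel"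
  let ?C = "(3 ^ (?N + 1))\<^sup>2 * kern_mass TYPE('a)"
  have C: "?C \<ge> 0"
    by (simp add: kern_mass_pos less_imp_le)
  have "(\<integral>\<^sup>+t\<in>{0<..<r}. ennreal (1 / t) * (\<integral>\<^sup>+y\<in>ball x r. kern_osc t y \<partial>lborel) \<partial>lborel) \<le>
    (\<integral>\<^sup>+t. ennreal (1 / t) * indicator {0<..<r} t * ?D t + ennreal (?C / r * r ^ ?N) * kern_osc r x * indicator {0<..<r} t \<partial>lborel)"
  proof (rule nn_integral_mono)
    fix t :: real
    show "ennreal (1 / t) * (\<integral>\<^sup>+y\<in>ball x r. kern_osc t y \<partial>lborel) * indicator {0<..<r} t \<le>
      ennreal (1 / t) * indicator {0<..<r} t * ?D t + ennreal (?C / r * r ^ ?N) * kern_osc r x * indicator {0<..<r} t"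
    proof (cases "t \<in> {0<..<r}")
      case True
      then have t: "0 < t" "t < r"
        by auto
      have "ennreal (1 / t) * (\<integral>\<^sup>+y\<in>ball x r. kern_osc t y \<partial>lborel) \<le>
          ennreal (1 / t) * (?D t + ennreal (?C * (t / r) * r ^ ?N) * kern_osc r x)"
        by (intro mult_left_mono nn_integral_kern_osc_ball t) auto
      also have "\<dots> = ennreal (1 / t) * ?D t + (ennreal (1 / t) * ennreal (?C * (t / r) * r ^ ?N)) * kern_osc r x"
        by (simp only: distrib_left mult.assoc)
      also have "ennreal (1 / t) * ennreal (?C * (t / r) * r ^ ?N) = ennreal (1 / t * (?C * (t / r) * r ^ ?N))"
        by (rule ennreal_mult'[symmetric]) (use t in simp)
      \<comment> \<open>The gain t/r of the far part cancels 1/t: what remains is constant in t, and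
        integrating over (0, r) only yields a factor r.\<close>
      also have "1 / t * (?C * (t / r) * r ^ ?N) = ?C / r * r ^ ?N"
        using t by simp
      finally show ?thesis
        using True by simp
    qed simp
  qed
  also have "\<dots> = (\<integral>\<^sup>+t. ennreal (1 / t) * indicator {0<..<r} t * ?D t \<partial>lborel) + ennreal (?C / r * r ^ ?N) * kern_osc r x * ennreal r"
    using r by (subst nn_integral_add) (measurable, simp add: nn_integral_cmult)
  also have "\<dots> \<le> ennreal (conv_const TYPE('a) * 2 ^ ?N * r ^ ?N) * Q + ennreal (?C * osc_const TYPE('a) * r ^ ?N) * Q"
  proof (rule add_mono)
    \<comment> \<open>In the near part the time integral is taken first, with z and w fixed; there
      it produces the singular weight.\<close>
    have "(\<integral>\<^sup>+t. ennreal (1 / t) * indicator {0<..<r} t * ?D t \<partial>lborel) =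
      (\<integral>\<^sup>+t. \<integral>\<^sup>+z. \<integral>\<^sup>+w. ennreal (1 / t) * indicator {0<..<r} t * (ennreal (conv_const TYPE('a) * kern t (w - z)) * ?E z w) \<partial>lborel \<partial>lborel \<partial>lborel)"
      by (simp add: nn_integral_cmult)
    also have "\<dots> = (\<integral>\<^sup>+z. \<integral>\<^sup>+w. \<integral>\<^sup>+t. ennreal (1 / t) * indicator {0<..<r} t * (ennreal (conv_const TYPE('a) * kern t (w - z)) * ?E z w) \<partial>lborel \<partial>lborel \<partial>lborel)"
      by (rule nn_integral_lborel_rotate) measurable
    also have "\<dots> \<le> (\<integral>\<^sup>+z. \<integral>\<^sup>+w. ennreal (conv_const TYPE('a)) *
        (ennreal ((a w - a z)\<^sup>2 / norm (w - z) ^ ?N) * indicator (ball x (2 * r)) w * indicator (ball x (2 * r)) z) \<partial>lborel \<partial>lborel)"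
    proof (intro nn_integral_mono)
      fix z w
      have "(\<integral>\<^sup>+t. ennreal (1 / t) * indicator {0<..<r} t * (ennreal (conv_const TYPE('a) * kern t (w - z)) * ?E z w) \<partial>lborel) =
        (\<integral>\<^sup>+t. ennreal (conv_const TYPE('a)) * ?E z w * (ennreal (kern t (w - z) / t) * indicator {0<..<r} t) \<partial>lborel)"
      proof (rule nn_integral_cong)
        fix t :: real
        show "ennreal (1 / t) * indicator {0<..<r} t * (ennreal (conv_const TYPE('a) * kern t (w - z)) * ?E z w) =
          ennreal (conv_const TYPE('a)) * ?E z w * (ennreal (kern t (w - z) / t) * indicator {0<..<r} t)"
        proof (cases "t \<in> {0<..<r}")
          case True
          then have 1: "ennreal (1 / t) * ennreal (conv_const TYPE('a) * kern t (w - z)) = ennreal (conv_const TYPE('a)) * ennreal (kern t (w - z) / t)"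
            using conv_const_pos[where 'a='a] by (simp flip: ennreal_mult)
          have gen: "p * 1 * (q * e) = c * e * (k * 1)" if "p * q = c * k" for p q c k e :: ennreal
            using arg_cong[OF that, of "\<lambda>s. s * e"] by (simp add: mult_ac)
          have 2: "indicator {0<..<r} t = (1 :: ennreal)"
            using True by simp
          show ?thesis
            unfolding 2 by (rule gen[OF 1])
        qed simp
      qed
      also have "\<dots> = ennreal (conv_const TYPE('a)) * ?E z w * (\<integral>\<^sup>+t\<in>{0<..<r}. ennreal (kern t (w - z) / t) \<partial>lborel)"
        by (rule nn_integral_cmult) measurable
      also have "\<dots> \<le> ennreal (conv_const TYPE('a)) *
        (ennreal ((a w - a z)\<^sup>2 / norm (w - z) ^ ?N) * indicator (ball x (2 * r)) w * indicator (ball x (2 * r)) z)"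
      \<comment> \<open>On the diagonal the time integral has no bound from
        \<open>nn_integral_kern_time\<close>, but \<open>sqdiff z z\<close> is 0 and annihilates
        it.\<close>
      proof (cases "w = z")
        case False
        have "ennreal (conv_const TYPE('a)) * ?E z w * (\<integral>\<^sup>+t\<in>{0<..<r}. ennreal (kern t (w - z) / t) \<partial>lborel) \<le>
          ennreal (conv_const TYPE('a)) * ?E z w * ennreal (1 / norm (w - z) ^ ?N)"
          using False by (intro mult_left_mono nn_integral_kern_time) auto
        also have "\<dots> = ennreal (conv_const TYPE('a)) *
          ((sqdiff z w * ennreal (1 / norm (w - z) ^ ?N)) * indicator (ball x (2 * r)) w * indicator (ball x (2 * r)) z)"
          by (simp only: mult_ac)
        also have "sqdiff z w * ennreal (1 / norm (w - z) ^ ?N) = ennreal ((a w - a z)\<^sup>2 / norm (w - z) ^ ?N)"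
          unfolding sqdiff_def by (simp add: power2_commute flip: ennreal_mult)
        finally show ?thesis .
      qed (simp add: sqdiff_def)
      finally show "(\<integral>\<^sup>+t. ennreal (1 / t) * indicator {0<..<r} t * (ennreal (conv_const TYPE('a) * kern t (w - z)) * ?E z w) \<partial>lborel)
        \<le> ennreal (conv_const TYPE('a)) *
        (ennreal ((a w - a z)\<^sup>2 / norm (w - z) ^ ?N) * indicator (ball x (2 * r)) w * indicator (ball x (2 * r)) z)" .
    qed
    also have "\<dots> = ennreal (conv_const TYPE('a)) *
      (\<integral>\<^sup>+z\<in>ball x (2 * r). (\<integral>\<^sup>+w\<in>ball x (2 * r). ennreal ((a w - a z)\<^sup>2 / norm (w - z) ^ ?N) \<partial>lborel) \<partial>lborel)"
      by (simp add: nn_integral_cmult nn_integral_multc)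
    also have "\<dots> \<le> ennreal (conv_const TYPE('a)) * (ennreal ((2 * r) ^ ?N) * Q)"
      using r by (intro mult_left_mono energy_le) auto
    also have "\<dots> = ennreal (conv_const TYPE('a) * 2 ^ ?N * r ^ ?N) * Q"
      using r conv_const_pos[where 'a='a] by (simp add: ennreal_mult power_mult_distrib mult.assoc less_imp_le)
    finally show "(\<integral>\<^sup>+t. ennreal (1 / t) * indicator {0<..<r} t * ?D t \<partial>lborel) \<le> ennreal (conv_const TYPE('a) * 2 ^ ?N * r ^ ?N) * Q" .
  next
    have "ennreal (?C / r * r ^ ?N) * kern_osc r x * ennreal r \<le> ennreal (?C / r * r ^ ?N) * (ennreal (osc_const TYPE('a)) * Q) * ennreal r"
      by (intro mult_left_mono mult_right_mono kern_osc_le r) auto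
    also have "\<dots> = (ennreal (?C / r * r ^ ?N) * ennreal (osc_const TYPE('a)) * ennreal r) * Q"
      by (simp only: mult_ac)
    also have "ennreal (?C / r * r ^ ?N) * ennreal (osc_const TYPE('a)) * ennreal r = ennreal (?C / r * r ^ ?N * osc_const TYPE('a) * r)"
    proof -
      have "ennreal b * ennreal k * ennreal l = ennreal (b * k * l)" if "0 \<le> b" "0 \<le> k" for b k l
        using that by (simp add: ennreal_mult')
      moreover have "0 \<le> ?C / r * r ^ ?N"
        using r C by simp
      ultimately show ?thesis
        using osc_const_pos[where 'a='a] less_imp_le by blast
    qed
    also have "?C / r * r ^ ?N * osc_const TYPE('a) * r = ?C * osc_const TYPE('a) * r ^ ?N"
      using r by simp
    finally show "ennreal (?C / r * r ^ ?N) * kern_osc r x * ennreal r \<le> ennreal (?C * osc_const TYPE('a) * r ^ ?N) * Q" .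
  qed
  also have "\<dots> = ennreal (carleson_const TYPE('a) * r ^ ?N) * Q"
  proof -
    have "ennreal (carleson_const TYPE('a) * r ^ ?N) = ennreal (conv_const TYPE('a) * 2 ^ ?N * r ^ ?N) + ennreal (?C * osc_const TYPE('a) * r ^ ?N)"
      using r C conv_const_pos[where 'a='a] osc_const_pos[where 'a='a]
      by (simp add: carleson_const_def distrib_right less_imp_le flip: ennreal_plus)
    then show ?thesis
      by (simp only: distrib_right)
  qed
  finally show ?thesis .
qed

end

subsection \<open>Differences of the extension\<close>

lemma nn_integral_weighted_Cauchy_Schwarz:
  fixes f g :: "'b \<Rightarrow> real"
  assumes [measurable]: "g \<in> borel_measurable M" "f \<in> borel_measurable M" and g: "\<And>x. g x \<ge> 0"
  shows "(\<integral>\<^sup>+x. ennreal (g x * \<bar>f x\<bar>) \<partial>M)\<^sup>2 \<le> (\<integral>\<^sup>+x. ennreal (g x) \<partial>M) * (\<integral>\<^sup>+x. ennreal (g x * (f x)\<^sup>2) \<partial>M)"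
proof -
  have "(\<integral>\<^sup>+x. ennreal (sqrt (g x)) * ennreal (sqrt (g x) * \<bar>f x\<bar>) \<partial>M)\<^sup>2 \<le>
    (\<integral>\<^sup>+x. (ennreal (sqrt (g x)))\<^sup>2 \<partial>M) * (\<integral>\<^sup>+x. (ennreal (sqrt (g x) * \<bar>f x\<bar>))\<^sup>2 \<partial>M)"
    by (rule Cauchy_Schwarz_nn_integral) measurable
  moreover have "ennreal (sqrt (g x)) * ennreal (sqrt (g x) * \<bar>f x\<bar>) = ennreal (g x * \<bar>f x\<bar>)" for x
    using g[of x] by (simp flip: ennreal_mult mult.assoc)
  moreover have "(ennreal (sqrt (g x)))\<^sup>2 = ennreal (g x)" "(ennreal (sqrt (g x) * \<bar>f x\<bar>))\<^sup>2 = ennreal (g x * (f x)\<^sup>2)" for x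
    using g[of x] by (simp_all add: ennreal_power power_mult_distrib)
  ultimately show ?thesis
    by simp
qed

lemma ennreal_square_integral_le:
  fixes F :: "'b \<Rightarrow> real"
  assumes F: "integrable M F" and le: "\<And>x. \<bar>F x\<bar> \<le> g x * \<bar>f x\<bar>"
    and [measurable]: "g \<in> borel_measurable M" "f \<in> borel_measurable M" and g: "\<And>x. g x \<ge> 0"
  shows "ennreal ((LINT x|M. F x)\<^sup>2) \<le> (\<integral>\<^sup>+x. ennreal (g x) \<partial>M) * (\<integral>\<^sup>+x. ennreal (g x * (f x)\<^sup>2) \<partial>M)"
proof -
  have "ennreal \<bar>LINT x|M. F x\<bar> \<le> (\<integral>\<^sup>+x. ennreal \<bar>F x\<bar> \<partial>M)"
    using integral_norm_bound_ennreal[OF F] by simp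
  also have "\<dots> \<le> (\<integral>\<^sup>+x. ennreal (g x * \<bar>f x\<bar>) \<partial>M)"
    by (intro nn_integral_mono ennreal_leI le)
  finally have "(ennreal \<bar>LINT x|M. F x\<bar>)\<^sup>2 \<le> (\<integral>\<^sup>+x. ennreal (g x * \<bar>f x\<bar>) \<partial>M)\<^sup>2"
    by (intro power_mono) auto
  also have "\<dots> \<le> (\<integral>\<^sup>+x. ennreal (g x) \<partial>M) * (\<integral>\<^sup>+x. ennreal (g x * (f x)\<^sup>2) \<partial>M)"
    by (rule nn_integral_weighted_Cauchy_Schwarz) (use g in auto)
  finally show ?thesis
    by (simp add: ennreal_power)
qed

section \<open>Extension by a kernel comparable to k_t\<close>

lemma integrable_kern:
  fixes y :: "'a::euclidean_space"
  assumes t: "t > 0"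
  shows "integrable lborel (\<lambda>z. kern t (y - z))"
proof (rule integrableI_bounded)
  have "(\<integral>\<^sup>+z. ennreal (norm (kern t (y - z))) \<partial>lborel) = (\<integral>\<^sup>+z. ennreal (kern t (y - z)) \<partial>lborel)"
    using t by simp
  also have "\<dots> < \<infinity>"
    using nn_integral_kern_reflect[OF t, of y] by (rule order.strict_trans1) simp
  finally show "(\<integral>\<^sup>+z. ennreal (norm (kern t (y - z))) \<partial>lborel) < \<infinity>" .
qed measurable

text \<open>On the ball of radius t the kernel is at least t / (2t)^(n+1); times the volume of that
  ball this is a lower bound free of t. It stands in for the exact mass of the Poisson
  kernel.\<close>

definition kern_mass_lower :: "'a::euclidean_space itself \<Rightarrow> real" where
  "kern_mass_lower _ = unit_ball_vol (real DIM('a)) / 2 ^ (DIM('a) + 1)"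

lemma kern_mass_lower_pos: "kern_mass_lower TYPE('a::euclidean_space) > 0"
  by (simp add: kern_mass_lower_def)

lemma nn_integral_kern_ge:
  fixes y :: "'a::euclidean_space"
  assumes t: "t > 0"
  shows "ennreal (kern_mass_lower TYPE('a)) \<le> (\<integral>\<^sup>+z. ennreal (kern t (y - z)) \<partial>lborel)"
proof -
  let ?N = "DIM('a)"
  have "ennreal (kern_mass_lower TYPE('a)) = ennreal (t / (2 * t) ^ (?N + 1) * (unit_ball_vol (real ?N) * t ^ ?N))"
    using t by (simp add: kern_mass_lower_def power_mult_distrib)
  also have "\<dots> = ennreal (t / (2 * t) ^ (?N + 1)) * ennreal (unit_ball_vol (real ?N) * t ^ ?N)"
    by (rule ennreal_mult') (use t in simp)
  also have "\<dots> = (\<integral>\<^sup>+z. ennreal (t / (2 * t) ^ (?N + 1)) * indicator (ball y t) z \<partial>lborel)"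
    using t by (subst nn_integral_cmult_indicator) (auto simp: emeasure_ball)
  also have "\<dots> \<le> (\<integral>\<^sup>+z. ennreal (kern t (y - z)) \<partial>lborel)"
  proof (rule nn_integral_mono)
    fix z
    show "ennreal (t / (2 * t) ^ (?N + 1)) * indicator (ball y t) z \<le> ennreal (kern t (y - z))"
    proof (cases "z \<in> ball y t")
      case True
      then have "t + norm (y - z) \<le> 2 * t"
        by (simp add: dist_norm)
      then have "t / (2 * t) ^ (?N + 1) \<le> kern t (y - z)"
        unfolding kern_def using t by (intro divide_left_mono power_mono mult_pos_pos zero_less_power) (auto simp: add_pos_nonneg)
      then show ?thesis
        using True by (simp add: ennreal_leI)
    qed simp
  qed
  finally show ?thesis .
qed

text \<open>The constant of \<open>ext_diff_square_le\<close> for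
  \<open>G = kern_mass TYPE('a)\<close>.\<close>

definition kern_ratio :: "'a::euclidean_space itself \<Rightarrow> real \<Rightarrow> real \<Rightarrow> real" where
  "kern_ratio _ c0 c1 = kern_mass TYPE('a) * c1 / (c0 * kern_mass_lower TYPE('a))"

lemma inverse_power_le_kern:
  fixes h :: "'a::euclidean_space"
  assumes "0 < t" "t < norm h"
  shows "1 / norm h ^ (DIM('a) + 1) \<le> 2 ^ (DIM('a) + 1) / t * kern t h"
proof -
  have "(t + norm h) ^ (DIM('a) + 1) \<le> (2 * norm h) ^ (DIM('a) + 1)"
    using assms by (intro power_mono) auto
  then have "(t + norm h) ^ (DIM('a) + 1) \<le> 2 ^ (DIM('a) + 1) * norm h ^ (DIM('a) + 1)"
    by (simp only: power_mult_distrib)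
  moreover have "0 < (t + norm h) ^ (DIM('a) + 1)" "0 < norm h ^ (DIM('a) + 1)"
    using assms by (intro zero_less_power; linarith)+
  moreover have "1 / q \<le> C / t * (t / s)" if "s \<le> C * q" "0 < s" "0 < q" for s q C :: real
    using that assms(1) by (simp add: field_simps)
  ultimately show ?thesis
    unfolding kern_def by blast
qed

text \<open>The term with \<open>c2\<close> comes from |h| <= t; the term with \<open>c1\<close>
  comes from |h| > t, where the shifted kernel costs a convolution and the unshifted one only a
  mass.\<close>

definition ext_const :: "'a::euclidean_space itself \<Rightarrow> real \<Rightarrow> real \<Rightarrow> real \<Rightarrow> real" where
  "ext_const _ c0 c1 c2 = kern_ratio TYPE('a) c0 c1 *
    (c2\<^sup>2 * kern_mass TYPE('a) + 2 * c1\<^sup>2 * 2 ^ (DIM('a) + 1) * (conv_const TYPE('a) + kern_mass TYPE('a)))"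

text \<open>The properties of the Poisson kernel at one fixed height t on which the difference
  estimate rests: comparability with k_t from both sides, and a gain |h|/t for small shifts.\<close>

locale kernel_extension = Q0_bound a Q for a :: "'a::euclidean_space \<Rightarrow> real" and Q +
  fixes p :: "'a \<Rightarrow> real" and t c0 c1 c2 :: real
  assumes p_measurable [measurable]: "p \<in> borel_measurable borel"
    and Q_finite: "Q < \<infinity>"
    and t_pos: "t > 0" and c_pos: "c0 > 0" "c1 > 0" "c2 > 0"
    and p_lower: "c0 * kern t x \<le> p x"
    and p_upper: "p x \<le> c1 * kern t x"
    and p_smooth: "norm h \<le> t \<Longrightarrow> \<bar>p (x + h) - p x\<bar> \<le> c2 * (norm h / t) * kern t x"
begin

definition ext :: "'a \<Rightarrow> real" where
  "ext y = (LINT z|lborel. p (y - z) * a z)"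

definition mass :: real where
  "mass = (LINT z|lborel. p z)"

lemma kern_nonneg_t [simp]: "kern t x \<ge> 0"
  using t_pos by simp

lemma p_nonneg: "p x \<ge> 0"
  using p_lower[of x] c_pos(1) by (auto intro: order_trans[rotated])

lemma kern_osc_finite: "kern_osc t y < \<infinity>"
  using kern_osc_le[OF t_pos, of y] by (rule order.strict_trans1) (use Q_finite in \<open>simp add: ennreal_mult_less_top\<close>)

lemma integrable_p: "integrable lborel (\<lambda>z. p (y - z))"
proof (rule Bochner_Integration.integrable_bound)
  show "integrable lborel (\<lambda>z. c1 * kern t (y - z))"
    by (intro integrable_mult_right integrable_kern t_pos)
qed (use p_nonneg p_upper in \<open>auto intro!: AE_I2 order_trans[OF p_upper]\<close>)

text \<open>Finiteness of V_t(y) makes the inner integral finite for at least one z. Comparing a(w)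
  with the fixed number a(z) then gives absolute convergence.\<close>

lemma integrable_kern_mult: "integrable lborel (\<lambda>z. kern t (y - z) * a z)"
proof (rule integrableI_bounded)
  have ae: "AE z in lborel. ennreal (kern t (y - z)) * (\<integral>\<^sup>+w. ennreal (kern t (y - w)) * sqdiff z w \<partial>lborel) \<noteq> \<infinity>"
    by (intro nn_integral_noteq_infinite) (use kern_osc_finite[of y] in \<open>auto simp: kern_osc_def osc_def\<close>)
  \<comment> \<open>If no such z existed, almost every point would satisfy \<open>False\<close>,
    although the whole space has positive measure.\<close>
  have "\<exists>z. ennreal (kern t (y - z)) * (\<integral>\<^sup>+w. ennreal (kern t (y - w)) * sqdiff z w \<partial>lborel) \<noteq> \<infinity>"
  proof (rule ccontr)
    assume "\<not> ?thesis"
    with ae have "AE z::'a in lborel. False"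
      by simp
    then show False
      using AE_iff_measurable[of "UNIV :: 'a set" lborel "\<lambda>_. False"] by simp
  qed
  then obtain z where z: "ennreal (kern t (y - z)) * (\<integral>\<^sup>+w. ennreal (kern t (y - w)) * sqdiff z w \<partial>lborel) \<noteq> \<infinity>"
    by blast
  have fin: "(\<integral>\<^sup>+w. ennreal (kern t (y - w)) * sqdiff z w \<partial>lborel) \<noteq> \<infinity>"
    using z kern_pos[OF t_pos, of "y - z"] by (auto simp: ennreal_mult_eq_top_iff)
  have "(\<integral>\<^sup>+w. ennreal (norm (kern t (y - w) * a w)) \<partial>lborel) \<le>
    (\<integral>\<^sup>+w. ennreal (\<bar>a z\<bar> + 1) * ennreal (kern t (y - w)) + ennreal (kern t (y - w)) * sqdiff z w \<partial>lborel)"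
  proof (rule nn_integral_mono)
    fix w
    \<comment> \<open>Linear growth is traded for a constant, integrable because the kernel has
      finite mass, plus the square whose integral is finite by the choice of z.\<close>
    have "\<bar>s\<bar> \<le> 1 + s\<^sup>2" for s :: real
      using zero_le_power2[of "\<bar>s\<bar> - 1"] zero_le_power2[of s] by (simp add: power2_eq_square algebra_simps)
    from this[of "a z - a w"] have "\<bar>a w\<bar> \<le> (\<bar>a z\<bar> + 1) + (a z - a w)\<^sup>2"
      by linarith
    then have "kern t (y - w) * \<bar>a w\<bar> \<le> kern t (y - w) * ((\<bar>a z\<bar> + 1) + (a z - a w)\<^sup>2)"
      by (intro mult_left_mono) auto
    then have "norm (kern t (y - w) * a w) \<le> (\<bar>a z\<bar> + 1) * kern t (y - w) + kern t (y - w) * (a z - a w)\<^sup>2"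
      by (simp add: abs_mult algebra_simps)
    then have "ennreal (norm (kern t (y - w) * a w)) \<le> ennreal ((\<bar>a z\<bar> + 1) * kern t (y - w) + kern t (y - w) * (a z - a w)\<^sup>2)"
      by (rule ennreal_leI)
    also have "\<dots> = ennreal (\<bar>a z\<bar> + 1) * ennreal (kern t (y - w)) + ennreal (kern t (y - w)) * sqdiff z w"
      unfolding sqdiff_def by (simp add: ennreal_mult del: ennreal_plus flip: ennreal_plus ennreal_mult)
    finally show "ennreal (norm (kern t (y - w) * a w)) \<le>
      ennreal (\<bar>a z\<bar> + 1) * ennreal (kern t (y - w)) + ennreal (kern t (y - w)) * sqdiff z w" .
  qed
  also have "\<dots> = ennreal (\<bar>a z\<bar> + 1) * (\<integral>\<^sup>+w. ennreal (kern t (y - w)) \<partial>lborel) +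
      (\<integral>\<^sup>+w. ennreal (kern t (y - w)) * sqdiff z w \<partial>lborel)"
    by (simp add: nn_integral_add nn_integral_cmult del: ennreal_plus)
  also have "\<dots> < \<infinity>"
  proof -
    have "(\<integral>\<^sup>+w. ennreal (kern t (y - w)) \<partial>lborel) < \<infinity>"
      using nn_integral_kern_reflect[OF t_pos, of y] by (rule order.strict_trans1) simp
    then show ?thesis
      using fin by (simp add: ennreal_mult_less_top less_top del: ennreal_plus)
  qed
  finally show "(\<integral>\<^sup>+w. ennreal (norm (kern t (y - w) * a w)) \<partial>lborel) < \<infinity>" .
qed measurable

lemma integrable_p_mult: "integrable lborel (\<lambda>z. p (y - z) * a z)"
proof (rule Bochner_Integration.integrable_bound)
  show "integrable lborel (\<lambda>z. c1 * (kern t (y - z) * a z))"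
    by (intro integrable_mult_right integrable_kern_mult)
  show "AE z in lborel. norm (p (y - z) * a z) \<le> norm (c1 * (kern t (y - z) * a z))"
  proof (rule AE_I2)
    fix z
    have "p (y - z) * \<bar>a z\<bar> \<le> (c1 * kern t (y - z)) * \<bar>a z\<bar>"
      by (intro mult_right_mono p_upper) auto
    then show "norm (p (y - z) * a z) \<le> norm (c1 * (kern t (y - z) * a z))"
      using c_pos p_nonneg by (simp add: abs_mult mult.assoc)
  qed
qed measurable

lemma nn_integral_p: "(\<integral>\<^sup>+z. ennreal (p (y - z)) \<partial>lborel) = ennreal mass"
proof -
  have "(\<integral>\<^sup>+z. ennreal (p (y - z)) \<partial>lborel) = (\<integral>\<^sup>+z. ennreal (p z) \<partial>lborel)"
    by (rule nn_integral_lborel_reflect) measurable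
  \<comment> \<open>The instance at 0 carries the finiteness given by \<open>integrable_p\<close>,
    which speaks of reflected arguments, over to the integral of p itself.\<close>
  moreover have "(\<integral>\<^sup>+z. ennreal (p (0 - z)) \<partial>lborel) = (\<integral>\<^sup>+z. ennreal (p z) \<partial>lborel)"
    by (rule nn_integral_lborel_reflect) measurable
  moreover have "mass = enn2real (\<integral>\<^sup>+z. ennreal (p z) \<partial>lborel)"
    unfolding mass_def by (rule integral_eq_nn_integral) (auto simp: p_nonneg)
  moreover have "(\<integral>\<^sup>+z. ennreal (p (0 - z)) \<partial>lborel) < \<infinity>"
    using integrable_p[of 0] p_nonneg by (simp add: integrable_iff_bounded)
  ultimately show ?thesis
    by simp
qed

lemma integral_p: "(LINT z|lborel. p (y - z)) = mass"
proof -
  have "ennreal (LINT z|lborel. p (y - z)) = ennreal mass"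
    using nn_integral_eq_integral[OF integrable_p[of y]] p_nonneg nn_integral_p[of y] by simp
  moreover have "mass \<ge> 0"
    unfolding mass_def by (simp add: p_nonneg)
  ultimately show ?thesis
    using p_nonneg by (subst (asm) ennreal_inj) auto
qed

lemma mass_ge: "c0 * kern_mass_lower TYPE('a) \<le> mass"
proof -
  have "ennreal (c0 * kern_mass_lower TYPE('a)) \<le> ennreal c0 * (\<integral>\<^sup>+z. ennreal (kern t (0 - z :: 'a)) \<partial>lborel)"
    using c_pos by (simp only: ennreal_mult' less_imp_le) (rule mult_left_mono[OF nn_integral_kern_ge[OF t_pos]], simp)
  also have "\<dots> = (\<integral>\<^sup>+z. ennreal (c0 * kern t (0 - z :: 'a)) \<partial>lborel)"
    using c_pos by (simp add: ennreal_mult' nn_integral_cmult)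
  also have "\<dots> \<le> (\<integral>\<^sup>+z. ennreal (p (0 - z)) \<partial>lborel)"
    by (intro nn_integral_mono ennreal_leI p_lower)
  also have "\<dots> = ennreal mass"
    by (rule nn_integral_p)
  finally show ?thesis
    using mass_def p_nonneg by (subst (asm) ennreal_le_iff) auto
qed

lemma mass_pos: "mass > 0"
  using mass_ge c_pos kern_mass_lower_pos[where 'a='a] by (auto intro: less_le_trans[rotated])

text \<open>Jensen for the probability density p(y - w) / mass, whose mean of a is
  \<open>ext y / mass\<close>. Cauchy-Schwarz gives the square of mass times the deviation, and one
  factor \<open>mass\<close> is cancelled.\<close>

lemma sqdiff_mean_le:
  "ennreal (mass * (a z - ext y / mass)\<^sup>2) \<le> ennreal c1 * (\<integral>\<^sup>+w. ennreal (kern t (y - w)) * sqdiff z w \<partial>lborel)"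
proof -
  have int: "integrable lborel (\<lambda>w. p (y - w) * (a z - a w))"
    using integrable_p[of y] integrable_p_mult[of y] by (simp add: right_diff_distrib)
  have "(LINT w|lborel. p (y - w) * (a z - a w)) = mass * a z - ext y"
    using integrable_p[of y] integrable_p_mult[of y] by (simp add: right_diff_distrib integral_p ext_def)
  also have "\<dots> = mass * (a z - ext y / mass)"
    using mass_pos by (simp add: field_simps)
  finally have "ennreal ((mass * (a z - ext y / mass))\<^sup>2) \<le>
      ennreal mass * (\<integral>\<^sup>+w. ennreal (p (y - w) * (a z - a w)\<^sup>2) \<partial>lborel)"
    using ennreal_square_integral_le[OF int, of "\<lambda>w. p (y - w)" "\<lambda>w. a z - a w"] p_nonneg
    by (simp add: nn_integral_p abs_mult)
  also have "\<dots> \<le> ennreal mass * (\<integral>\<^sup>+w. ennreal c1 * (ennreal (kern t (y - w)) * sqdiff z w) \<partial>lborel)"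
  proof (intro mult_left_mono nn_integral_mono)
    fix w
    have "p (y - w) * (a z - a w)\<^sup>2 \<le> c1 * kern t (y - w) * (a z - a w)\<^sup>2"
      by (intro mult_right_mono p_upper) auto
    then show "ennreal (p (y - w) * (a z - a w)\<^sup>2) \<le> ennreal c1 * (ennreal (kern t (y - w)) * sqdiff z w)"
      unfolding sqdiff_def using c_pos by (simp add: ennreal_leI mult.assoc flip: ennreal_mult)
  qed simp
  also have "\<dots> = ennreal mass * (ennreal c1 * (\<integral>\<^sup>+w. ennreal (kern t (y - w)) * sqdiff z w \<partial>lborel))"
    by (simp add: nn_integral_cmult)
  also have "ennreal ((mass * (a z - ext y / mass))\<^sup>2) = ennreal mass * ennreal (mass * (a z - ext y / mass)\<^sup>2)"
    using mass_pos by (simp add: power_mult_distrib power2_eq_square mult_ac flip: ennreal_mult)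
  finally show ?thesis
    using mass_pos by (subst (asm) ennreal_mult_le_mult_iff) auto
qed

text \<open>A majorant g of the kernel difference is used twice: as the weight in Cauchy-Schwarz,
  where its mass appears as G, and as the first weight of \<open>osc\<close>, after
  \<open>sqdiff_mean_le\<close> has replaced the squared deviation from the mean by an integral
  against k_t.\<close>

lemma ext_diff_square_le:
  assumes g_le: "\<And>z. \<bar>p (y + h - z) - p (y - z)\<bar> \<le> g z"
    and [measurable]: "g \<in> borel_measurable borel"
    and g_mass: "(\<integral>\<^sup>+z. ennreal (g z) \<partial>lborel) \<le> ennreal G" and G: "G \<ge> 0"
  shows "ennreal ((ext (y + h) - ext y)\<^sup>2) \<le>
    ennreal (G * c1 / (c0 * kern_mass_lower TYPE('a))) * osc (\<lambda>z. ennreal (g z)) (\<lambda>z. ennreal (kern t (y - z)))"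
proof -
  define m where "m = ext y / mass"
  define l where "l = c0 * kern_mass_lower TYPE('a)"
  have l: "l > 0" "l \<le> mass"
    using mass_ge c_pos kern_mass_lower_pos[where 'a='a] by (simp_all add: l_def)
  have g: "g z \<ge> 0" for z
    using g_le[of z] by linarith
  let ?F = "\<lambda>z. (p (y + h - z) - p (y - z)) * (a z - m)"
  have "?F = (\<lambda>z. (p (y + h - z) * a z - p (y - z) * a z) - m * (p (y + h - z) - p (y - z)))"
    by (auto simp: algebra_simps)
  \<comment> \<open>The shifted and the unshifted kernel have equal mass, so the constant m drops
    out of the integral.\<close>
  then have int: "integrable lborel ?F" and eq: "(LINT z|lborel. ?F z) = ext (y + h) - ext y"
    using integrable_p_mult[of "y + h"] integrable_p_mult[of y] integrable_p[of "y + h"] integrable_p[of y]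
    by (simp_all add: ext_def integral_p)
  have "\<bar>?F z\<bar> \<le> g z * \<bar>a z - m\<bar>" for z
    unfolding abs_mult by (intro mult_right_mono g_le) auto
  then have "ennreal ((ext (y + h) - ext y)\<^sup>2) \<le> (\<integral>\<^sup>+z. ennreal (g z) \<partial>lborel) * (\<integral>\<^sup>+z. ennreal (g z * (a z - m)\<^sup>2) \<partial>lborel)"
    using g unfolding eq[symmetric] by (intro ennreal_square_integral_le int) auto
  also have "\<dots> \<le> ennreal G * (\<integral>\<^sup>+z. ennreal (g z * (a z - m)\<^sup>2) \<partial>lborel)"
    by (intro mult_right_mono g_mass) auto
  also have "\<dots> \<le> ennreal G * (\<integral>\<^sup>+z. ennreal (c1 / l) * (ennreal (g z) * (\<integral>\<^sup>+w. ennreal (kern t (y - w)) * sqdiff z w \<partial>lborel)) \<partial>lborel)"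
  proof (intro mult_left_mono nn_integral_mono)
    fix z
    have "l * (a z - m)\<^sup>2 \<le> mass * (a z - m)\<^sup>2"
      using l by (intro mult_right_mono) auto
    then have "(a z - m)\<^sup>2 \<le> 1 / l * (mass * (a z - m)\<^sup>2)"
      using l by (simp add: field_simps)
    then have "g z * (a z - m)\<^sup>2 \<le> g z * (1 / l * (mass * (a z - m)\<^sup>2))"
      by (intro mult_left_mono g)
    then have "ennreal (g z * (a z - m)\<^sup>2) \<le> ennreal (g z * (1 / l * (mass * (a z - m)\<^sup>2)))"
      by (rule ennreal_leI)
    also have "\<dots> = ennreal (g z) * (ennreal (1 / l) * ennreal (mass * (a z - m)\<^sup>2))"
      using g l by (simp only: ennreal_mult' zero_le_divide_1_iff less_imp_le)
    also have "\<dots> \<le> ennreal (g z) * (ennreal (1 / l) * (ennreal c1 * (\<integral>\<^sup>+w. ennreal (kern t (y - w)) * sqdiff z w \<partial>lborel)))"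
      unfolding m_def by (intro mult_left_mono sqdiff_mean_le) auto
    also have "\<dots> = (ennreal (1 / l) * ennreal c1) * (ennreal (g z) * (\<integral>\<^sup>+w. ennreal (kern t (y - w)) * sqdiff z w \<partial>lborel))"
      by (simp only: mult_ac)
    also have "ennreal (1 / l) * ennreal c1 = ennreal (c1 / l)"
      using l c_pos by (simp flip: ennreal_mult)
    finally show "ennreal (g z * (a z - m)\<^sup>2) \<le>
      ennreal (c1 / l) * (ennreal (g z) * (\<integral>\<^sup>+w. ennreal (kern t (y - w)) * sqdiff z w \<partial>lborel))" .
  qed simp
  also have "\<dots> = (ennreal G * ennreal (c1 / l)) * osc (\<lambda>z. ennreal (g z)) (\<lambda>z. ennreal (kern t (y - z)))"
    unfolding osc_def by (simp add: nn_integral_cmult mult.assoc)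
  also have "ennreal G * ennreal (c1 / l) = ennreal (G * c1 / l)"
    using G l c_pos by (simp flip: ennreal_mult)
  finally show ?thesis
    unfolding l_def .
qed

lemma kern_ratio_pos: "kern_ratio TYPE('a) c0 c1 > 0"
  using c_pos by (simp add: kern_ratio_def kern_mass_pos kern_mass_lower_pos)

text \<open>The gain |h|/t of the majorant enters once through G and once through the weight. The
  resulting |h|^2 makes the singularity |h|^(-n-1) integrable at 0.\<close>

lemma ext_diff_near:
  assumes h: "norm h \<le> t"
  shows "ennreal ((ext (y + h) - ext y)\<^sup>2) \<le> ennreal (c2\<^sup>2 * kern_ratio TYPE('a) c0 c1 / t\<^sup>2 * (norm h)\<^sup>2) * kern_osc t y"
proof -
  let ?c = "c2 * (norm h / t)"
  have c: "?c \<ge> 0"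
    using c_pos t_pos by simp
  have "ennreal ((ext (y + h) - ext y)\<^sup>2) \<le>
    ennreal ((?c * kern_mass TYPE('a)) * c1 / (c0 * kern_mass_lower TYPE('a))) *
      osc (\<lambda>z. ennreal (?c * kern t (y - z))) (\<lambda>z. ennreal (kern t (y - z)))"
  proof (rule ext_diff_square_le)
    show "\<bar>p (y + h - z) - p (y - z)\<bar> \<le> ?c * kern t (y - z)" for z
      using p_smooth[OF h, of "y - z"] by (simp add: algebra_simps)
    have "(\<integral>\<^sup>+z. ennreal (?c * kern t (y - z)) \<partial>lborel) = ennreal ?c * (\<integral>\<^sup>+z. ennreal (kern t (y - z)) \<partial>lborel)"
      using c by (simp only: ennreal_mult') (rule nn_integral_cmult, measurable)
    also have "\<dots> \<le> ennreal ?c * ennreal (kern_mass TYPE('a))"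
      by (intro mult_left_mono nn_integral_kern_reflect t_pos) auto
    finally show "(\<integral>\<^sup>+z. ennreal (?c * kern t (y - z)) \<partial>lborel) \<le> ennreal (?c * kern_mass TYPE('a))"
      using c by (simp only: ennreal_mult')
    show "0 \<le> ?c * kern_mass TYPE('a)"
      by (intro mult_nonneg_nonneg c less_imp_le kern_mass_pos)
  qed measurable
  also have "osc (\<lambda>z. ennreal (?c * kern t (y - z))) (\<lambda>z. ennreal (kern t (y - z))) = ennreal ?c * kern_osc t y"
    unfolding kern_osc_def using c by (simp only: ennreal_mult') (rule osc_cmult, measurable)
  also have "ennreal ((?c * kern_mass TYPE('a)) * c1 / (c0 * kern_mass_lower TYPE('a))) * (ennreal ?c * kern_osc t y) =
    (ennreal ?c * ennreal ((?c * kern_mass TYPE('a)) * c1 / (c0 * kern_mass_lower TYPE('a)))) * kern_osc t y"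
    by (simp only: mult_ac)
  also have "ennreal ?c * ennreal ((?c * kern_mass TYPE('a)) * c1 / (c0 * kern_mass_lower TYPE('a))) =
      ennreal (?c * ((?c * kern_mass TYPE('a)) * c1 / (c0 * kern_mass_lower TYPE('a))))"
    by (rule ennreal_mult'[OF c, symmetric])
  also have "?c * ((?c * kern_mass TYPE('a)) * c1 / (c0 * kern_mass_lower TYPE('a))) = c2\<^sup>2 * kern_ratio TYPE('a) c0 c1 / t\<^sup>2 * (norm h)\<^sup>2"
    unfolding kern_ratio_def by (simp add: power2_eq_square mult_ac)
  finally show ?thesis .
qed

text \<open>No cancellation is sought between the two kernels: the majorant is their sum, and the
  decay in h comes from |h|^(-n-1) alone.\<close>

lemma ext_diff_far:
  "ennreal ((ext (y + h) - ext y)\<^sup>2) \<le> ennreal (2 * c1\<^sup>2 * kern_ratio TYPE('a) c0 c1) *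
    (osc (\<lambda>z. ennreal (kern t (y + h - z))) (\<lambda>z. ennreal (kern t (y - z))) + kern_osc t y)"
proof -
  let ?g = "\<lambda>z. c1 * (kern t (y + h - z) + kern t (y - z))"
  have eq: "ennreal (?g z) = ennreal c1 * (ennreal (kern t (y + h - z)) + ennreal (kern t (y - z)))" for z
    using c_pos by (simp add: ennreal_mult)
  have "ennreal ((ext (y + h) - ext y)\<^sup>2) \<le>
    ennreal ((2 * c1 * kern_mass TYPE('a)) * c1 / (c0 * kern_mass_lower TYPE('a))) *
      osc (\<lambda>z. ennreal (?g z)) (\<lambda>z. ennreal (kern t (y - z)))"
  proof (rule ext_diff_square_le)
    show "\<bar>p (y + h - z) - p (y - z)\<bar> \<le> ?g z" for z
      using p_upper[of "y + h - z"] p_upper[of "y - z"] p_nonneg[of "y + h - z"] p_nonneg[of "y - z"]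
        kern_nonneg_t[of "y + h - z"] kern_nonneg_t[of "y - z"] unfolding distrib_left by linarith
    have "(\<integral>\<^sup>+z. ennreal (?g z) \<partial>lborel) =
      ennreal c1 * ((\<integral>\<^sup>+z. ennreal (kern t (y + h - z)) \<partial>lborel) + (\<integral>\<^sup>+z. ennreal (kern t (y - z)) \<partial>lborel))"
      unfolding eq by (simp add: nn_integral_cmult nn_integral_add)
    also have "\<dots> \<le> ennreal c1 * (ennreal (kern_mass TYPE('a)) + ennreal (kern_mass TYPE('a)))"
      by (intro mult_left_mono add_mono nn_integral_kern_reflect t_pos) auto
    also have "\<dots> = ennreal (2 * c1 * kern_mass TYPE('a))"
      using c_pos kern_mass_pos[where 'a='a] by (simp flip: ennreal_mult ennreal_plus)
    finally show "(\<integral>\<^sup>+z. ennreal (?g z) \<partial>lborel) \<le> ennreal (2 * c1 * kern_mass TYPE('a))" .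
    show "0 \<le> 2 * c1 * kern_mass TYPE('a)"
      using c_pos kern_mass_pos[where 'a='a] by simp
  qed measurable
  also have "osc (\<lambda>z. ennreal (?g z)) (\<lambda>z. ennreal (kern t (y - z))) =
    ennreal c1 * (osc (\<lambda>z. ennreal (kern t (y + h - z))) (\<lambda>z. ennreal (kern t (y - z))) + kern_osc t y)"
    unfolding kern_osc_def eq by (subst osc_cmult, measurable, subst osc_add, measurable)
  also have "ennreal ((2 * c1 * kern_mass TYPE('a)) * c1 / (c0 * kern_mass_lower TYPE('a))) * (ennreal c1 * R) =
    ennreal (2 * c1\<^sup>2 * kern_ratio TYPE('a) c0 c1) * R" for R
  proof -
    have "ennreal ((2 * c1 * kern_mass TYPE('a)) * c1 / (c0 * kern_mass_lower TYPE('a))) = ennreal (2 * c1 * kern_ratio TYPE('a) c0 c1)"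
      by (simp add: kern_ratio_def mult_ac)
    moreover have "ennreal (2 * c1 * kern_ratio TYPE('a) c0 c1) * ennreal c1 = ennreal (2 * c1\<^sup>2 * kern_ratio TYPE('a) c0 c1)"
      using c_pos kern_ratio_pos by (simp add: power2_eq_square mult_ac flip: ennreal_mult)
    ultimately show ?thesis
      by (simp only: mult.assoc[symmetric])
  qed
  finally show ?thesis .
qed

lemma nn_integral_ext_diff:
  "(\<integral>\<^sup>+h. ennreal ((ext (y + h) - ext y)\<^sup>2 / norm h ^ (DIM('a) + 1)) \<partial>lborel) \<le>
    ennreal (ext_const TYPE('a) c0 c1 c2 / t) * kern_osc t y"
proof -
  let ?N = "DIM('a)"
  let ?O = "\<lambda>h. osc (\<lambda>z. ennreal (kern t (y + h - z))) (\<lambda>z. ennreal (kern t (y - z)))"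
  let ?A = "c2\<^sup>2 * kern_ratio TYPE('a) c0 c1 / t\<^sup>2" and ?B = "2 * c1\<^sup>2 * kern_ratio TYPE('a) c0 c1 * (2 ^ (?N + 1) / t)"
  have A: "?A \<ge> 0" and B: "?B \<ge> 0"
    using kern_ratio_pos t_pos by simp_all
  have [measurable]: "(\<lambda>h. ?O h) \<in> borel_measurable borel"
    unfolding osc_def by measurable
  \<comment> \<open>Both regimes are merged into one bound valid for every h. Only the near term
    keeps its cutoff; the far term is left on the whole space, where the mass and convolution bounds
    apply.\<close>
  have "ennreal ((ext (y + h) - ext y)\<^sup>2 / norm h ^ (?N + 1)) \<le>
      ennreal ?A * kern_osc t y * (ennreal (norm h ^ 2 / norm h ^ (?N + 1)) * indicator (cball 0 t) h) +
      ennreal ?B * (ennreal (kern t h) * ?O h + ennreal (kern t h) * kern_osc t y)" for h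
  proof (cases "norm h \<le> t")
    case True
    have "ennreal ((ext (y + h) - ext y)\<^sup>2 / norm h ^ (?N + 1)) =
        ennreal (1 / norm h ^ (?N + 1)) * ennreal ((ext (y + h) - ext y)\<^sup>2)"
      by (simp flip: ennreal_mult)
    also have "\<dots> \<le> ennreal (1 / norm h ^ (?N + 1)) * (ennreal (?A * (norm h)\<^sup>2) * kern_osc t y)"
      by (intro mult_left_mono ext_diff_near True) auto
    also have "\<dots> = ennreal ?A * kern_osc t y * (ennreal (norm h ^ 2 / norm h ^ (?N + 1)) * indicator (cball 0 t) h)"
    proof -
      have 1: "ennreal (1 / norm h ^ (?N + 1)) * ennreal (?A * (norm h)\<^sup>2) = ennreal ?A * ennreal (norm h ^ 2 / norm h ^ (?N + 1))"
      proof -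
        have *: "ennreal (1 / d) * ennreal (b * s) = ennreal b * ennreal (s / d)" if "0 \<le> b" "0 \<le> s" "0 \<le> d" for b s d
          using that by (simp flip: ennreal_mult)
        show ?thesis
          by (rule *[OF A]) auto
      qed
      have 2: "indicator (cball 0 t) h = (1 :: ennreal)"
        using True by simp
      have gen: "e * (f * k) = b * k * (g * 1)" if "e * f = b * g" for e f k b g :: ennreal
        using arg_cong[OF that, of "\<lambda>s. s * k"] by (simp add: mult_ac)
      show ?thesis
        unfolding 2 by (rule gen[OF 1])
    qed
    finally show ?thesis
      by (rule order_trans) simp
  next
    case False
    have "ennreal ((ext (y + h) - ext y)\<^sup>2 / norm h ^ (?N + 1)) =
        ennreal (1 / norm h ^ (?N + 1)) * ennreal ((ext (y + h) - ext y)\<^sup>2)"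
      by (simp flip: ennreal_mult)
    also have "\<dots> \<le> ennreal (2 ^ (?N + 1) / t * kern t h) * (ennreal (2 * c1\<^sup>2 * kern_ratio TYPE('a) c0 c1) * (?O h + kern_osc t y))"
      using False t_pos by (intro mult_mono ext_diff_far ennreal_leI inverse_power_le_kern) auto
    also have "ennreal (2 ^ (?N + 1) / t * kern t h) = ennreal (2 ^ (?N + 1) / t) * ennreal (kern t h)"
      by (rule ennreal_mult') (use t_pos in simp)
    also have "ennreal (2 ^ (?N + 1) / t) * ennreal (kern t h) * (ennreal (2 * c1\<^sup>2 * kern_ratio TYPE('a) c0 c1) * (?O h + kern_osc t y)) =
      (ennreal (2 * c1\<^sup>2 * kern_ratio TYPE('a) c0 c1) * ennreal (2 ^ (?N + 1) / t)) * (ennreal (kern t h) * ?O h + ennreal (kern t h) * kern_osc t y)"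
      by (simp only: mult_ac distrib_left)
    also have "ennreal (2 * c1\<^sup>2 * kern_ratio TYPE('a) c0 c1) * ennreal (2 ^ (?N + 1) / t) = ennreal ?B"
      by (rule ennreal_mult'[symmetric]) (use kern_ratio_pos in simp)
    finally show ?thesis
      by (rule order_trans) simp
  qed
  then have "(\<integral>\<^sup>+h. ennreal ((ext (y + h) - ext y)\<^sup>2 / norm h ^ (?N + 1)) \<partial>lborel) \<le>
    (\<integral>\<^sup>+h. ennreal ?A * kern_osc t y * (ennreal (norm h ^ 2 / norm h ^ (?N + 1)) * indicator (cball 0 t) h) +
      ennreal ?B * (ennreal (kern t h) * ?O h + ennreal (kern t h) * kern_osc t y) \<partial>lborel)"
    by (rule nn_integral_mono)
  also have "\<dots> = ennreal ?A * kern_osc t y * (\<integral>\<^sup>+h. ennreal (norm (h :: 'a) ^ 2 / norm h ^ (?N + 1)) * indicator (cball 0 t) h \<partial>lborel) +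
      ennreal ?B * ((\<integral>\<^sup>+h. ennreal (kern t h) * ?O h \<partial>lborel) + (\<integral>\<^sup>+h. ennreal (kern t (h :: 'a)) \<partial>lborel) * kern_osc t y)"
  proof -
    have *: "(\<integral>\<^sup>+h. b * f h + d * (g h + k h * v) \<partial>lborel) = b * (\<integral>\<^sup>+h. f h \<partial>lborel) + d * ((\<integral>\<^sup>+h. g h \<partial>lborel) + (\<integral>\<^sup>+h. k h \<partial>lborel) * v)"
      if [measurable]: "f \<in> borel_measurable borel" "g \<in> borel_measurable borel" "k \<in> borel_measurable borel"
      for f g k :: "'a \<Rightarrow> ennreal" and b d v
      by (simp add: nn_integral_add nn_integral_cmult nn_integral_multc)
    show ?thesis
      by (rule *) (auto intro!: borel_measurable_times_ennreal borel_measurable_indicator)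
  qed
  also have "\<dots> \<le> ennreal ?A * kern_osc t y * ennreal (kern_mass TYPE('a) * t) +
      ennreal ?B * (ennreal (conv_const TYPE('a)) * kern_osc t y + ennreal (kern_mass TYPE('a)) * kern_osc t y)"
  proof (intro add_mono mult_left_mono mult_right_mono nn_integral_inner_singular nn_integral_kern t_pos)
    \<comment> \<open>With h integrated first, the kernel centred at y + h is convolved with
      \<open>kern t h\<close> and becomes a multiple of the kernel centred at y.\<close>
    have "(\<integral>\<^sup>+h. ennreal (kern t h) * ?O h \<partial>lborel) =
      (\<integral>\<^sup>+h. \<integral>\<^sup>+z. \<integral>\<^sup>+w. ennreal (kern t h) * (ennreal (kern t (y + h - z)) * (ennreal (kern t (y - w)) * sqdiff z w)) \<partial>lborel \<partial>lborel \<partial>lborel)"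
      unfolding osc_def by (simp add: nn_integral_cmult)
    also have "\<dots> = (\<integral>\<^sup>+z. \<integral>\<^sup>+w. \<integral>\<^sup>+h. ennreal (kern t h) * (ennreal (kern t (y + h - z)) * (ennreal (kern t (y - w)) * sqdiff z w)) \<partial>lborel \<partial>lborel \<partial>lborel)"
      by (rule nn_integral_lborel_rotate) measurable
    also have "\<dots> = (\<integral>\<^sup>+z. \<integral>\<^sup>+w. (\<integral>\<^sup>+h. ennreal (kern t h * kern t ((y - z) + h)) \<partial>lborel) * (ennreal (kern t (y - w)) * sqdiff z w) \<partial>lborel \<partial>lborel)"
    proof -
      have "ennreal (kern t h) * (ennreal (kern t (y + h - z)) * e) = ennreal (kern t h * kern t ((y - z) + h)) * e" for h z e
      proof -
        have "y + h - z = (y - z) + h"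
          by simp
        then show ?thesis
          by (simp only: ennreal_mult' kern_nonneg_t mult.assoc)
      qed
      then show ?thesis
        by (simp add: nn_integral_multc)
    qed
    also have "\<dots> \<le> (\<integral>\<^sup>+z. \<integral>\<^sup>+w. ennreal (conv_const TYPE('a) * kern t (y - z)) * (ennreal (kern t (y - w)) * sqdiff z w) \<partial>lborel \<partial>lborel)"
      by (intro nn_integral_mono mult_right_mono nn_integral_kern_convolution t_pos) auto
    also have "\<dots> = ennreal (conv_const TYPE('a)) * kern_osc t y"
      unfolding kern_osc_eq using conv_const_pos[where 'a='a]
      by (simp only: ennreal_mult' less_imp_le mult.assoc) (simp add: nn_integral_cmult)
    finally show "(\<integral>\<^sup>+h. ennreal (kern t h) * ?O h \<partial>lborel) \<le> ennreal (conv_const TYPE('a)) * kern_osc t y" .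
  qed auto
  also have "\<dots> = (ennreal ?A * ennreal (kern_mass TYPE('a) * t) + ennreal ?B * (ennreal (conv_const TYPE('a)) + ennreal (kern_mass TYPE('a)))) * kern_osc t y"
    by (simp only: distrib_left distrib_right mult_ac)
  also have "ennreal ?A * ennreal (kern_mass TYPE('a) * t) + ennreal ?B * (ennreal (conv_const TYPE('a)) + ennreal (kern_mass TYPE('a)))
    = ennreal (?A * (kern_mass TYPE('a) * t) + ?B * (conv_const TYPE('a) + kern_mass TYPE('a)))"
  proof -
    have "ennreal b * ennreal k + ennreal d * (ennreal l + ennreal m) = ennreal (b * k + d * (l + m))"
      if "0 \<le> b" "0 \<le> k" "0 \<le> d" "0 \<le> l" "0 \<le> m" for b k d l m
      using that by (simp flip: ennreal_mult ennreal_plus)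
    moreover have "0 \<le> kern_mass TYPE('a) * t" "0 \<le> conv_const TYPE('a)" "0 \<le> kern_mass TYPE('a)"
      using t_pos kern_mass_pos[where 'a='a] conv_const_pos[where 'a='a] by simp_all
    ultimately show ?thesis
      using A B by blast
  qed
  \<comment> \<open>\<open>?A\<close> has order 1/t^2 and the near integral order t, while
    \<open>?B\<close> itself has order 1/t; both products are multiples of 1/t.\<close>
  also have "?A * (kern_mass TYPE('a) * t) + ?B * (conv_const TYPE('a) + kern_mass TYPE('a)) = ext_const TYPE('a) c0 c1 c2 / t"
    using t_pos unfolding ext_const_def by (simp add: power2_eq_square field_simps)
  finally show ?thesis .
qed

end

subsection \<open>The Poisson kernel\<close>

text \<open>From ((1 + s)/2)^2 <= 1 + s^2 <= (1 + s)^2 by applying the decreasing power with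
  exponent -(N+1)/2.\<close>

lemma poisson_radial_bounds:
  fixes s :: real and N :: nat
  assumes s: "s \<ge> 0"
  shows "1 / (1 + s) ^ (N + 1) \<le> (1 + s\<^sup>2) powr (- (real N + 1) / 2)"
    and "(1 + s\<^sup>2) powr (- (real N + 1) / 2) \<le> 2 ^ (N + 1) / (1 + s) ^ (N + 1)"
proof -
  have sq: "(u\<^sup>2) powr (- (real N + 1) / 2) = 1 / u ^ (N + 1)" if "u > 0" for u :: real
  proof -
    have "(u\<^sup>2) powr (- (real N + 1) / 2) = (u powr 2) powr (- (real N + 1) / 2)"
      using that by simp
    also have "\<dots> = u powr - real (N + 1)"
    proof -
      have "2 * (- (real N + 1) / 2) = - real (N + 1)"
        by (simp add: field_simps)
      then show ?thesis
        by (simp only: powr_powr)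
    qed
    also have "\<dots> = 1 / u ^ (N + 1)"
      using that by (simp only: powr_minus powr_realpow inverse_eq_divide)
    finally show ?thesis .
  qed
  have "1 / (1 + s) ^ (N + 1) = ((1 + s)\<^sup>2) powr (- (real N + 1) / 2)"
    using s by (subst sq) auto
  also have "\<dots> \<le> (1 + s\<^sup>2) powr (- (real N + 1) / 2)"
    using s by (intro powr_mono2') (auto simp: power2_eq_square algebra_simps add_pos_nonneg)
  finally show "1 / (1 + s) ^ (N + 1) \<le> (1 + s\<^sup>2) powr (- (real N + 1) / 2)" .
  have "2 * s \<le> 1 + s\<^sup>2"
    using zero_le_power2[of "s - 1"] by (simp add: power2_eq_square algebra_simps)
  moreover have "((1 + s) / 2)\<^sup>2 = (1 + 2 * s + s\<^sup>2) / 4"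
    by (simp add: power2_eq_square field_simps)
  moreover have "v \<le> 1 + q" if "2 * s \<le> 1 + q" "v = (1 + 2 * s + q) / 4" "0 \<le> q" for v q :: real
    using that by argo
  ultimately have le: "((1 + s) / 2)\<^sup>2 \<le> 1 + s\<^sup>2"
    using zero_le_power2 by blast
  have "(1 + s\<^sup>2) powr (- (real N + 1) / 2) \<le> (((1 + s) / 2)\<^sup>2) powr (- (real N + 1) / 2)"
    using s le by (intro powr_mono2') auto
  also have "\<dots> = 2 ^ (N + 1) / (1 + s) ^ (N + 1)"
    using s by (subst sq) (auto simp: power_divide)
  finally show "(1 + s\<^sup>2) powr (- (real N + 1) / 2) \<le> 2 ^ (N + 1) / (1 + s) ^ (N + 1)" .
qed

text \<open>Mean value theorem for the profile: its logarithmic derivative is at most (N+1)/2 in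
  absolute value because 2x <= 1 + x^2. One factor 2^(N+1) comes from the upper radial bound at the
  intermediate point x, the other from 1 + s <= 2 (1 + x).\<close>

lemma poisson_radial_lipschitz:
  fixes s u :: real and N :: nat
  assumes s: "s \<ge> 0" "u \<ge> 0" and su: "\<bar>u - s\<bar> \<le> 1"
  shows "\<bar>(1 + u\<^sup>2) powr (- (real N + 1) / 2) - (1 + s\<^sup>2) powr (- (real N + 1) / 2)\<bar> \<le>
    real (N + 1) * 4 ^ (N + 1) * \<bar>u - s\<bar> / (1 + s) ^ (N + 1)"
proof -
  define \<beta> where "\<beta> = - (real N + 1) / 2"
  define \<phi> where "\<phi> x = (1 + x\<^sup>2) powr \<beta>" for x :: real
  define \<phi>' where "\<phi>' x = \<beta> * (2 * x / (1 + x\<^sup>2)) * \<phi> x" for x :: real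
  have pos: "1 + x\<^sup>2 > 0" for x :: real
    by (simp add: add_pos_nonneg)
  have deriv: "(\<phi> has_real_derivative \<phi>' x) (at x)" for x
    unfolding \<phi>_def[abs_def] \<phi>'_def
    using pos[of x] by (auto intro!: derivative_eq_intros simp: powr_diff)
  have bound: "\<bar>\<phi>' x\<bar> \<le> real (N + 1) * 4 ^ (N + 1) / (1 + s) ^ (N + 1)" if x: "x \<ge> 0" "s \<le> x + 1" for x
  proof -
    have "2 * x \<le> 1 + x\<^sup>2"
      using zero_le_power2[of "x - 1"] by (simp add: power2_eq_square algebra_simps)
    then have 1: "\<bar>2 * x / (1 + x\<^sup>2)\<bar> \<le> 1"
      using x pos[of x] by simp
    have \<phi>: "0 \<le> \<phi> x" "\<phi> x \<le> 2 ^ (N + 1) / (1 + x) ^ (N + 1)"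
      using poisson_radial_bounds(2)[OF x(1), of N] by (simp_all add: \<phi>_def \<beta>_def)
    have "(1 + s) ^ (N + 1) \<le> (2 * (1 + x)) ^ (N + 1)"
      using s x by (intro power_mono) auto
    then have "(1 + s) ^ (N + 1) \<le> 2 ^ (N + 1) * (1 + x) ^ (N + 1)"
      by (simp only: power_mult_distrib)
    moreover have "0 < (1 + s) ^ (N + 1)" "0 < (1 + x) ^ (N + 1)"
      using s x by (intro zero_less_power; linarith)+
    moreover have "c / q \<le> c * c / p" if "p \<le> c * q" "0 < p" "0 < q" "0 < c" for p q c :: real
      using that by (simp add: field_simps)
    moreover have "0 < (2 :: real) ^ (N + 1)"
      by simp
    ultimately have "2 ^ (N + 1) / (1 + x) ^ (N + 1) \<le> 2 ^ (N + 1) * 2 ^ (N + 1) / (1 + s) ^ (N + 1)"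
      by blast
    also have "\<dots> = 4 ^ (N + 1) / (1 + s) ^ (N + 1)"
      using power_mult_distrib[of "2 :: real" 2 "N + 1"] by simp
    finally have 2: "\<phi> x \<le> 4 ^ (N + 1) / (1 + s) ^ (N + 1)"
      using \<phi> by linarith
    have "\<bar>\<phi>' x\<bar> = \<bar>\<beta>\<bar> * \<bar>2 * x / (1 + x\<^sup>2)\<bar> * \<phi> x"
      using \<phi> by (simp add: \<phi>'_def abs_mult)
    also have "\<dots> \<le> real (N + 1) * 1 * (4 ^ (N + 1) / (1 + s) ^ (N + 1))"
      using 1 2 \<phi> s by (intro mult_mono) (auto simp: \<beta>_def)
    finally show ?thesis
      by simp
  qed
  \<comment> \<open>One statement for both orders of u and s, and for u = s. The point x lies
    between them, so |u - s| <= 1 gives \<open>s \<le> x + 1\<close>.\<close>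
  have "\<exists>x. x \<ge> 0 \<and> s \<le> x + 1 \<and> \<bar>\<phi> u - \<phi> s\<bar> = \<bar>u - s\<bar> * \<bar>\<phi>' x\<bar>"
  proof -
    consider "u = s" | "s < u" | "u < s"
      by linarith
    then show ?thesis
    proof cases
      case 1
      then show ?thesis
        using s by (intro exI[of _ s]) auto
    next
      case 2
      then obtain x where "s < x" "x < u" "\<phi> u - \<phi> s = (u - s) * \<phi>' x"
        using MVT2[of s u \<phi> \<phi>'] deriv by blast
      then show ?thesis
        using s by (intro exI[of _ x]) (auto simp: abs_mult)
    next
      case 3
      then obtain x where x: "u < x" "x < s" "\<phi> s - \<phi> u = (s - u) * \<phi>' x"
        using MVT2[of u s \<phi> \<phi>'] deriv by blast
      then have "\<bar>\<phi> u - \<phi> s\<bar> = \<bar>u - s\<bar> * \<bar>\<phi>' x\<bar>"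
        by (metis abs_minus_commute abs_mult)
      then show ?thesis
        using s su x by (intro exI[of _ x]) auto
    qed
  qed
  then obtain x where x: "x \<ge> 0" "s \<le> x + 1" "\<bar>\<phi> u - \<phi> s\<bar> = \<bar>u - s\<bar> * \<bar>\<phi>' x\<bar>"
    by blast
  have "\<bar>u - s\<bar> * \<bar>\<phi>' x\<bar> \<le> \<bar>u - s\<bar> * (real (N + 1) * 4 ^ (N + 1) / (1 + s) ^ (N + 1))"
    using x by (intro mult_left_mono bound) auto
  then show ?thesis
    using x by (simp add: \<phi>_def \<beta>_def mult_ac)
qed

lemma gamma_const_pos: "gamma_const N > 0"
  unfolding gamma_const_def by (intro divide_pos_pos Gamma_real_pos) auto

lemma kern_eq_scaled:
  fixes x :: "'a::euclidean_space"
  assumes t: "t > 0"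
  shows "kern t x = (1 / t ^ DIM('a)) * (1 / (1 + norm x / t) ^ (DIM('a) + 1))"
proof -
  have "t + norm x = t * (1 + norm x / t)"
    using t by (simp add: field_simps)
  then have "kern t x = t / (t ^ (DIM('a) + 1) * (1 + norm x / t) ^ (DIM('a) + 1))"
    unfolding kern_def by (simp only: power_mult_distrib)
  also have "\<dots> = (1 / t ^ DIM('a)) * (1 / (1 + norm x / t) ^ (DIM('a) + 1))"
    using t by simp
  finally show ?thesis .
qed

lemma poisson_kernel_eq:
  fixes x :: "real ^ 'n"
  assumes t: "t > 0"
  shows "poisson_kernel t x = gamma_const CARD('n) * ((1 / t ^ CARD('n)) *
    (1 + (norm x / t)\<^sup>2) powr (- (real CARD('n) + 1) / 2))"
proof -
  have "norm (x /\<^sub>R t) = norm x / t"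
    using t by (simp add: divide_inverse mult.commute)
  then show ?thesis
    unfolding poisson_kernel_def poisson_profile_def by (simp only: mult.left_commute)
qed

lemma poisson_kernel_bounds:
  fixes x :: "real ^ 'n"
  assumes t: "t > 0"
  shows "gamma_const CARD('n) * kern t x \<le> poisson_kernel t x"
    and "poisson_kernel t x \<le> gamma_const CARD('n) * 2 ^ (CARD('n) + 1) * kern t x"
proof -
  let ?N = "CARD('n)" and ?s = "norm x / t"
  have s: "?s \<ge> 0" and d: "1 / t ^ ?N \<ge> 0"
    using t by simp_all
  have k: "kern t x = (1 / t ^ ?N) * (1 / (1 + ?s) ^ (?N + 1))"
    using kern_eq_scaled[OF t, of x] by simp
  show "gamma_const ?N * kern t x \<le> poisson_kernel t x"
    unfolding poisson_kernel_eq[OF t] k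
    by (intro mult_left_mono poisson_radial_bounds(1) s d less_imp_le gamma_const_pos)
  have "poisson_kernel t x \<le> gamma_const ?N * ((1 / t ^ ?N) * (2 ^ (?N + 1) / (1 + ?s) ^ (?N + 1)))"
    unfolding poisson_kernel_eq[OF t]
    by (intro mult_left_mono poisson_radial_bounds(2) s d less_imp_le gamma_const_pos)
  then show "poisson_kernel t x \<le> gamma_const ?N * 2 ^ (?N + 1) * kern t x"
    unfolding k by (simp add: mult_ac)
qed

text \<open>The kernel is radial, so the reverse triangle inequality reduces the shift by h to a
  change of the radius by at most |h|/t after scaling.\<close>

lemma poisson_kernel_lipschitz:
  fixes x h :: "real ^ 'n"
  assumes t: "t > 0" and h: "norm h \<le> t"
  shows "\<bar>poisson_kernel t (x + h) - poisson_kernel t x\<bar> \<le>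
    gamma_const CARD('n) * (real (CARD('n) + 1) * 4 ^ (CARD('n) + 1)) * (norm h / t) * kern t x"
proof -
  let ?N = "CARD('n)" and ?s = "norm x / t" and ?u = "norm (x + h) / t"
  let ?\<phi> = "\<lambda>s. (1 + s\<^sup>2) powr (- (real CARD('n) + 1) / 2)" and ?L = "real (?N + 1) * 4 ^ (?N + 1)"
  have \<gamma>: "gamma_const ?N > 0" and s: "?s \<ge> 0" "?u \<ge> 0" and d: "1 / t ^ ?N \<ge> 0"
    using t gamma_const_pos by simp_all
  have k: "kern t x = (1 / t ^ ?N) * (1 / (1 + ?s) ^ (?N + 1))"
    using kern_eq_scaled[OF t, of x] by simp
  have "\<bar>norm (x + h) - norm x\<bar> \<le> norm h"
    using norm_triangle_ineq3[of "x + h" x] by simp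
  then have su: "\<bar>?u - ?s\<bar> \<le> norm h / t"
    using t by (simp add: divide_right_mono flip: diff_divide_distrib)
  also have "\<dots> \<le> 1"
    using t h by simp
  finally have "\<bar>?\<phi> ?u - ?\<phi> ?s\<bar> \<le> ?L * \<bar>?u - ?s\<bar> / (1 + ?s) ^ (?N + 1)"
    by (intro poisson_radial_lipschitz s)
  also have "\<dots> \<le> ?L * (norm h / t) / (1 + ?s) ^ (?N + 1)"
    using s by (intro divide_right_mono mult_left_mono su) auto
  finally have le: "\<bar>?\<phi> ?u - ?\<phi> ?s\<bar> \<le> ?L * (norm h / t) / (1 + ?s) ^ (?N + 1)" .
  have "poisson_kernel t (x + h) - poisson_kernel t x = gamma_const ?N * ((1 / t ^ ?N) * (?\<phi> ?u - ?\<phi> ?s))"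
    unfolding poisson_kernel_eq[OF t] by (simp only: right_diff_distrib)
  then have "\<bar>poisson_kernel t (x + h) - poisson_kernel t x\<bar> = gamma_const ?N * ((1 / t ^ ?N) * \<bar>?\<phi> ?u - ?\<phi> ?s\<bar>)"
    using \<gamma> d by (simp only: abs_mult abs_of_nonneg abs_of_pos)
  also have "\<dots> \<le> gamma_const ?N * ((1 / t ^ ?N) * (?L * (norm h / t) / (1 + ?s) ^ (?N + 1)))"
    using \<gamma> by (intro mult_left_mono le d) auto
  also have "\<dots> = gamma_const ?N * ?L * (norm h / t) * kern t x"
  proof -
    have "g * (d * (l * e / p)) = g * l * e * (d * (1 / p))" for g d l e p :: real
      by simp
    then show ?thesis
      unfolding k by blast
  qed
  finally show ?thesis .
qed

lemma poisson_kernel_measurable [measurable]: "poisson_kernel t \<in> borel_measurable borel"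
  unfolding poisson_kernel_def[abs_def] poisson_profile_def by measurable

section \<open>From the energies to the seminorms\<close>

definition poisson_ext_const :: "'n::finite itself \<Rightarrow> real" where
  "poisson_ext_const _ = ext_const TYPE(real ^ 'n) (gamma_const CARD('n)) (gamma_const CARD('n) * 2 ^ (CARD('n) + 1))
    (gamma_const CARD('n) * (real (CARD('n) + 1) * 4 ^ (CARD('n) + 1)))"

lemma poisson_ext_const_pos: "poisson_ext_const TYPE('n::finite) > 0"
  unfolding poisson_ext_const_def ext_const_def kern_ratio_def
  by (intro mult_pos_pos add_pos_pos divide_pos_pos gamma_const_pos kern_mass_pos kern_mass_lower_pos conv_const_pos zero_less_power)
    (simp_all add: gamma_const_pos)

text \<open>The difference estimate at each height is inserted into the Carleson estimate; the
  factor r^n there cancels against the volume of the ball in the average.\<close>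

lemma A_inf_energy_le:
  fixes a :: "real ^ 'n \<Rightarrow> real"
  assumes a: "a \<in> Q0_space"
  defines "C \<equiv> gamma_const CARD('n) / 2 * poisson_ext_const TYPE('n) * carleson_const TYPE(real ^ 'n) / unit_ball_vol (real CARD('n))"
  shows "A_inf_energy a \<le> ennreal C * Q0_energy a"
proof -
  let ?N = "CARD('n)"
  let ?Q = "Q0_energy a"
  have a_meas [measurable]: "a \<in> borel_measurable lebesgue" and fin: "?Q < \<infinity>"
    using a by (auto simp: Q0_space_def)
  \<comment> \<open>Neither the energy nor the Poisson extension sees the change from
    \<open>a\<close> to this Borel representative.\<close>
  obtain b where b [measurable]: "b \<in> borel_measurable borel" and ab: "AE x in lborel. a x = b x"
    using completion_ex_borel_measurable_real[OF a_meas] by auto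
  interpret Q0_bound b ?Q
  proof
    fix x :: "real ^ 'n" and r :: real
    assume r: "r > 0"
    let ?I = "\<integral>\<^sup>+z\<in>ball x r. (\<integral>\<^sup>+y\<in>ball x r. ennreal (\<bar>a y - a z\<bar>\<^sup>2 / norm (y - z) ^ ?N) \<partial>lebesgue) \<partial>lebesgue"
    have "ennreal (1 / r ^ ?N) * ?I \<le> ?Q"
      unfolding Q0_energy_def by (rule SUP_upper2[OF UNIV_I], rule SUP_upper) (use r in simp)
    then have "ennreal (r ^ ?N) * (ennreal (1 / r ^ ?N) * ?I) \<le> ennreal (r ^ ?N) * ?Q"
      by (rule mult_left_mono) simp
    moreover have "ennreal (r ^ ?N) * ennreal (1 / r ^ ?N) = 1"
      using r by (simp flip: ennreal_mult)
    ultimately have I: "?I \<le> ennreal (r ^ ?N) * ?Q"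
      by (simp flip: mult.assoc)
    have "(\<integral>\<^sup>+z\<in>ball x r. (\<integral>\<^sup>+w\<in>ball x r. ennreal ((b w - b z)\<^sup>2 / norm (w - z) ^ DIM(real ^ 'n)) \<partial>lborel) \<partial>lborel) = ?I"
      unfolding nn_integral_completion
    proof (rule nn_integral_cong_AE)
      \<comment> \<open>Almost everywhere equality acts twice: for almost every z the values at z
        agree, and for such a fixed z the inner integrands agree for almost every w.\<close>
      show "AE z in lborel. (\<integral>\<^sup>+w\<in>ball x r. ennreal ((b w - b z)\<^sup>2 / norm (w - z) ^ DIM(real ^ 'n)) \<partial>lborel) * indicator (ball x r) z =
        (\<integral>\<^sup>+y\<in>ball x r. ennreal (\<bar>a y - a z\<bar>\<^sup>2 / norm (y - z) ^ ?N) \<partial>lborel) * indicator (ball x r) z"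
        using ab
      proof eventually_elim
        case (elim z)
        have "(\<integral>\<^sup>+w\<in>ball x r. ennreal ((b w - b z)\<^sup>2 / norm (w - z) ^ DIM(real ^ 'n)) \<partial>lborel) =
          (\<integral>\<^sup>+y\<in>ball x r. ennreal (\<bar>a y - a z\<bar>\<^sup>2 / norm (y - z) ^ ?N) \<partial>lborel)"
          by (rule nn_integral_cong_AE, use ab in eventually_elim) (simp add: elim)
        then show ?case
          by simp
      qed
    qed
    with I show "(\<integral>\<^sup>+z\<in>ball x r. (\<integral>\<^sup>+w\<in>ball x r. ennreal ((b w - b z)\<^sup>2 / norm (w - z) ^ DIM(real ^ 'n)) \<partial>lborel) \<partial>lborel)
        \<le> ennreal (r ^ DIM(real ^ 'n)) * ?Q"
      by simp
  qed (rule b)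
  have half: "d_half_sq (poisson_ext a t) y \<le> ennreal (gamma_const ?N / 2 * poisson_ext_const TYPE('n) / t) * kern_osc t y"
    if t: "t > 0" for t y
  proof -
    interpret kernel_extension b ?Q "poisson_kernel t" t "gamma_const ?N" "gamma_const ?N * 2 ^ (?N + 1)"
      "gamma_const ?N * (real (?N + 1) * 4 ^ (?N + 1))"
      by (intro kernel_extension.intro kernel_extension_axioms.intro Q0_bound_axioms poisson_kernel_measurable
          fin t gamma_const_pos mult_pos_pos poisson_kernel_bounds poisson_kernel_lipschitz) auto
    \<comment> \<open>Equality holds at every point, not just almost everywhere, so it can be
      substituted in \<open>d_half_sq\<close>, which evaluates the extension at the single point
      y.\<close>
    have ext: "poisson_ext a t z = ext z" for z
    proof -
      have "poisson_ext a t z = (LINT y|lebesgue. poisson_kernel t (z - y) * b y)"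
        unfolding poisson_ext_def
      proof (rule integral_cong_AE)
        show "(\<lambda>y. poisson_kernel t (z - y) * a y) \<in> borel_measurable lebesgue"
          by (intro borel_measurable_times a_meas measurable_completion) measurable
        show "(\<lambda>y. poisson_kernel t (z - y) * b y) \<in> borel_measurable lebesgue"
          by (intro measurable_completion) measurable
        show "AE y in lebesgue. poisson_kernel t (z - y) * a y = poisson_kernel t (z - y) * b y"
          unfolding AE_completion_iff using ab by eventually_elim simp
      qed
      also have "\<dots> = ext z"
        unfolding ext_def by (rule integral_completion) measurable
      finally show ?thesis .
    qed
    have "d_half_sq (poisson_ext a t) y = ennreal (gamma_const ?N / 2) *
        (\<integral>\<^sup>+h. ennreal ((ext (y + h) - ext y)\<^sup>2 / norm h ^ (DIM(real ^ 'n) + 1)) \<partial>lborel)"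
      unfolding d_half_sq_def ext nn_integral_completion by simp
    also have "\<dots> \<le> ennreal (gamma_const ?N / 2) * (ennreal (poisson_ext_const TYPE('n) / t) * kern_osc t y)"
      unfolding poisson_ext_const_def by (intro mult_left_mono nn_integral_ext_diff) auto
    also have "\<dots> = (ennreal (gamma_const ?N / 2) * ennreal (poisson_ext_const TYPE('n) / t)) * kern_osc t y"
      by (simp only: mult.assoc)
    also have "ennreal (gamma_const ?N / 2) * ennreal (poisson_ext_const TYPE('n) / t) = ennreal (gamma_const ?N / 2 * (poisson_ext_const TYPE('n) / t))"
      by (rule ennreal_mult'[symmetric]) (simp add: gamma_const_pos less_imp_le)
    finally show ?thesis
      by simp
  qed
  let ?K = "gamma_const ?N / 2 * poisson_ext_const TYPE('n)"
  have K: "?K > 0"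
    by (simp add: gamma_const_pos poisson_ext_const_pos)
  have "(\<integral>\<^sup>+t\<in>{0<..<r}. (\<integral>\<^sup>+y\<in>ball x r. d_half_sq (poisson_ext a t) y \<partial>lebesgue) / emeasure lebesgue (ball x r) \<partial>lebesgue)
      \<le> ennreal C * ?Q" if r: "r > 0" for r x
  proof -
    define V where "V = unit_ball_vol (real ?N) * r ^ ?N"
    have V: "V > 0"
      using r by (simp add: V_def)
    have em: "emeasure lebesgue (ball x r) = ennreal V"
      using r by (simp add: V_def emeasure_ball)
    have "(\<integral>\<^sup>+t\<in>{0<..<r}. (\<integral>\<^sup>+y\<in>ball x r. d_half_sq (poisson_ext a t) y \<partial>lebesgue) / emeasure lebesgue (ball x r) \<partial>lebesgue) \<le>
      (\<integral>\<^sup>+t. ennreal (?K / V) * (ennreal (1 / t) * (\<integral>\<^sup>+y\<in>ball x r. kern_osc t y \<partial>lborel) * indicator {0<..<r} t) \<partial>lborel)"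
      unfolding nn_integral_completion
    proof (rule nn_integral_mono)
      fix t :: real
      show "(\<integral>\<^sup>+y\<in>ball x r. d_half_sq (poisson_ext a t) y \<partial>lborel) / emeasure lebesgue (ball x r) * indicator {0<..<r} t \<le>
        ennreal (?K / V) * (ennreal (1 / t) * (\<integral>\<^sup>+y\<in>ball x r. kern_osc t y \<partial>lborel) * indicator {0<..<r} t)"
      proof (cases "t \<in> {0<..<r}")
        case True
        then have t: "t > 0"
          by simp
        have "(\<integral>\<^sup>+y\<in>ball x r. d_half_sq (poisson_ext a t) y \<partial>lborel) \<le> (\<integral>\<^sup>+y\<in>ball x r. ennreal (?K / t) * kern_osc t y \<partial>lborel)"
          by (intro nn_integral_mono mult_right_mono half t) auto
        also have "\<dots> = ennreal (?K / t) * (\<integral>\<^sup>+y\<in>ball x r. kern_osc t y \<partial>lborel)"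
          by (simp add: mult.assoc nn_integral_cmult)
        finally have "(\<integral>\<^sup>+y\<in>ball x r. d_half_sq (poisson_ext a t) y \<partial>lborel) / emeasure lebesgue (ball x r) \<le>
          ennreal (?K / t) * (\<integral>\<^sup>+y\<in>ball x r. kern_osc t y \<partial>lborel) / ennreal V"
          unfolding em by (rule divide_right_mono_ennreal)
        also have "\<dots> = (ennreal (?K / t) / ennreal V) * (\<integral>\<^sup>+y\<in>ball x r. kern_osc t y \<partial>lborel)"
          by (simp add: ennreal_times_divide mult.commute)
        also have "ennreal (?K / t) / ennreal V = ennreal (?K / V) * ennreal (1 / t)"
          using t V K by (simp add: divide_ennreal mult_ac flip: ennreal_mult)
        finally show ?thesis
          using True by (simp add: mult.assoc)
      qed simp
    qed
    also have "\<dots> = ennreal (?K / V) * (\<integral>\<^sup>+t\<in>{0<..<r}. ennreal (1 / t) * (\<integral>\<^sup>+y\<in>ball x r. kern_osc t y \<partial>lborel) \<partial>lborel)"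
      by (rule nn_integral_cmult) measurable
    also have "\<dots> \<le> ennreal (?K / V) * (ennreal (carleson_const TYPE(real ^ 'n) * r ^ DIM(real ^ 'n)) * ?Q)"
      by (intro mult_left_mono carleson_estimate r) auto
    also have "\<dots> = (ennreal (?K / V) * ennreal (carleson_const TYPE(real ^ 'n) * r ^ ?N)) * ?Q"
      by (simp add: mult.assoc)
    also have "ennreal (?K / V) * ennreal (carleson_const TYPE(real ^ 'n) * r ^ ?N) = ennreal (?K / V * (carleson_const TYPE(real ^ 'n) * r ^ ?N))"
      by (rule ennreal_mult'[symmetric]) (use K V in simp)
    also have "?K / V * (carleson_const TYPE(real ^ 'n) * r ^ ?N) = C"
      using r unfolding V_def C_def by simp
    finally show ?thesis .
  qed
  then show ?thesis
    unfolding A_inf_energy_def by (intro SUP_least) auto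
qed

text \<open>Finiteness of y passes to x, so both square roots are taken in the real branch, where
  \<open>enn2real\<close> loses nothing.\<close>

lemma ennreal_sqrt_le_mult:
  assumes le: "x \<le> ennreal C * y" and C: "C \<ge> 0" and fin: "y < \<infinity>"
  shows "ennreal_sqrt x \<le> ennreal (sqrt C) * ennreal_sqrt y"
proof -
  have y: "y = ennreal (enn2real y)"
    using fin by simp
  have "x \<le> ennreal (C * enn2real y)"
    using le y C by (metis ennreal_mult')
  then have x: "x < \<infinity>" "enn2real x \<le> C * enn2real y"
    using C by (auto intro: enn2real_leI order.strict_trans1)
  then have "sqrt (enn2real x) \<le> sqrt C * sqrt (enn2real y)"
    by (simp flip: real_sqrt_mult)
  then have "ennreal (sqrt (enn2real x)) \<le> ennreal (sqrt C) * ennreal (sqrt (enn2real y))"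
    using C by (simp add: ennreal_leI flip: ennreal_mult)
  then show ?thesis
    using x fin by (auto simp: ennreal_sqrt_def)
qed

theorem theorem4:
  shows "\<exists>c::real. c > 0 \<and>
    (\<forall>a \<in> (Q0_space :: (real ^ 'n \<Rightarrow> real) set).
       A_inf_seminorm a \<le> ennreal c * Q0_seminorm a)"
proof -
  define C where "C = gamma_const CARD('n) / 2 * poisson_ext_const TYPE('n) *
    carleson_const TYPE(real ^ 'n) / unit_ball_vol (real CARD('n))"
  have C: "C > 0"
    unfolding C_def by (simp add: gamma_const_pos poisson_ext_const_pos carleson_const_pos)
  have "A_inf_seminorm a \<le> ennreal (sqrt C) * Q0_seminorm a" if a: "a \<in> Q0_space" for a :: "real ^ 'n \<Rightarrow> real"
    unfolding A_inf_seminorm_def Q0_seminorm_def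
  proof (rule ennreal_sqrt_le_mult)
    show "A_inf_energy a \<le> ennreal C * Q0_energy a"
      unfolding C_def by (rule A_inf_energy_le) (rule a)
  qed (use C a in \<open>auto simp: Q0_space_def\<close>)
  then show ?thesis
    using C by (intro exI[of _ "sqrt C"]) auto
qed

end
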